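(* Let $R$ be a commutative unital ring and let $M$ be a finitely generated $R$-module with $S_M\ne\emptyset$ such that $R/\mathfrak{m}$ is infinite for every $\mathfrak{m}\in S_M$. Equip $M$ with the induced Zariski topology, and let $\kappa_M=\min_{\mathfrak{m}\in S_M}|R/\mathfrak{m}|+1$. If the image of $M$ under the map $q:M\rightarrow\prod_{\mathfrak{m}\in \mathrm{mSpec}(R)}M/\mathfrak{m}M$ is not of first $\kappa_M$-category, then $\sigma_{\tau}(M,R)=\kappa_M$. In particular, $\sigma(M,R)=\kappa_M$.
   Context: $\mathrm{mSpec}(R)$ is the set of maximal ideals of $R$, and $S_M=\{\mathfrak{m}\in\mathrm{mSpec}(R):\dim_{R/\mathfrak{m}}(M/\mathfrak{m}M)\ge 2\}$. Induced Zariski topology on a finite-dimensional vector space $V$ over a field $\mathbf{K}$: identify $V$ with $\mathbf{K}^n$ by a basis; closed sets are the common zero sets of families of polynomials in $\mathbf{K}[X_1,\dots,X_n]$ (independent of the basis). Induced Zariski topology on a finitely generated $R$-module $M$: topologize each $M/\mathfrak{m}M$ with the induced Zariski topology as an $R/\mathfrak{m}$-vector space if $\mathfrak{m}\in S_M$, and with the topology whose only closed sets are $\emptyset,\{0\},M/\mathfrak{m}M$ if $\mathfrak{m}\notin S_M$; give $\prod_{\mathfrak{m}\in\mathrm{mSpec}(R)}M/\mathfrak{m}M$ the product topology; and give $M$ the coarsest topology making $q:M\to\prod_{\mathfrak{m}\in\mathrm{mSpec}(R)}M/\mathfrak{m}M$, $q(x)=(x+\mathfrak{m}M)_{\mathfrak{m}}$,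 continuous. The image $q(M)$ carries the subspace topology of the product. $\sigma(M,R)$ is the minimum cardinal number of proper $R$-submodules of $M$ whose union is $M$; $\sigma_\tau(M,R)$ is the minimum cardinal number of proper closed subsets of $M$ (induced Zariski topology) whose union is $M$. For an infinite cardinal $\kappa$, a space $X$ is of first $\kappa$-category if it is a union of fewer than $\kappa$ nowhere dense subsets of $X$. *)

theory Defs
  imports
    "HOL-Analysis.Function_Topology"
    "HOL-Algebra.QuotRing"
    "HOL-Algebra.Indexed_Polynomials"
    "Jordan_Normal_Form.Missing_VectorSpace"
begin

unbundle cardinal_syntax

hide_const (open) Multiset.mult

definition fin_gen_module :: "('r, 'x) ring_scheme \<Rightarrow> ('r, 'm, 'y) module_scheme \<Rightarrow> bool" where
  "fin_gen_module R M \<longleftrightarrow> Module.module R M \<and>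
     (\<exists>A. finite A \<and> A \<subseteq> carrier M \<and> LinearCombinations.module.span R M A = carrier M)"

definition mSpec :: "('r, 'x) ring_scheme \<Rightarrow> 'r set set" where
  "mSpec R = {\<mm>. maximalideal \<mm> R}"

definition ideal_smult ::
  "('r, 'x) ring_scheme \<Rightarrow> ('r, 'm, 'y) module_scheme \<Rightarrow> 'r set \<Rightarrow> 'm set" where
  "ideal_smult R M I =
     LinearCombinations.module.span R M {a \<odot>\<^bsub>M\<^esub> x | a x. a \<in> I \<and> x \<in> carrier M}"

text \<open>
  \<open>M/IM\<close> as an \<open>R/I\<close>-module. A module record extends a ring record, and its fields \<open>mult\<close>
  and \<open>one\<close> carry no meaning. Scalar multiplication is the analogue of
  \<^const>\<open>rcoset_mult\<close> in \<^const>\<open>FactRing\<close>: the union is a single coset.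
\<close>
definition residue_module ::
  "('r, 'x) ring_scheme \<Rightarrow> ('r, 'm, 'y) module_scheme \<Rightarrow> 'r set \<Rightarrow> ('r set, 'm set) module" where
  "residue_module R M I = (let N = ideal_smult R M I in
     \<lparr>carrier = a_rcosets\<^bsub>M\<^esub> N, mult = (\<lambda>_ _. N), one = N, zero = N, add = set_add M,
      smult = (\<lambda>\<alpha> \<xi>. \<Union>a\<in>\<alpha>. \<Union>x\<in>\<xi>. N +>\<^bsub>M\<^esub> (a \<odot>\<^bsub>M\<^esub> x))\<rparr>)"

definition S_set :: "('r, 'x) ring_scheme \<Rightarrow> ('r, 'm, 'y) module_scheme \<Rightarrow> 'r set set" where
  "S_set R M = {\<mm> \<in> mSpec R. vectorspace.dim (R Quot \<mm>) (residue_module R M \<mm>) \<ge> 2}"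

definition topology_of_closed :: "'a set \<Rightarrow> 'a set set \<Rightarrow> 'a topology" where
  "topology_of_closed V \<C> = topology (\<lambda>U. \<exists>C\<in>\<C>. U = V - C)"

text \<open>
  Elements of \<open>K[X\<^sub>i | i \<in> I]\<close> are represented in \<^theory>\<open>HOL-Algebra.Indexed_Polynomials\<close> as
  coefficient functions on monomials, a monomial being a multiset of variables.
\<close>
definition indexed_poly_eval :: "('k, 'x) ring_scheme \<Rightarrow> ('i multiset \<Rightarrow> 'k) \<Rightarrow> ('i \<Rightarrow> 'k) \<Rightarrow> 'k" where
  "indexed_poly_eval K P c =
     (\<Oplus>\<^bsub>K\<^esub>m\<in>{m. P m \<noteq> \<zero>\<^bsub>K\<^esub>}. P m \<otimes>\<^bsub>K\<^esub> (\<Otimes>\<^bsub>K\<^esub>i\<in>set_mset m. c i [^]\<^bsub>K\<^esub> count m i))"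

text \<open>
  A basis \<open>B\<close> identifies \<open>K\<^sup>B\<close> with \<open>V\<close> by \<open>c \<mapsto> \<Sum>b\<in>B. c b \<cdot> b\<close>. Coordinates and variables are
  indexed by the basis vectors themselves instead of by \<open>1, \<dots>, n\<close>.
\<close>
definition zariski_zero_set ::
  "('k, 'x) ring_scheme \<Rightarrow> ('k, 'v, 'y) module_scheme \<Rightarrow> 'v set \<Rightarrow> ('v multiset \<Rightarrow> 'k) set \<Rightarrow> 'v set" where
  "zariski_zero_set K V B F =
     {LinearCombinations.module.lincomb V c B | c.
        c \<in> B \<rightarrow>\<^sub>E carrier K \<and> (\<forall>P\<in>F. indexed_poly_eval K P c = \<zero>\<^bsub>K\<^esub>)}"

text \<open>The topology does not depend on the finite basis \<open>B\<close> that is picked.\<close>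
definition zariski_topology ::
  "('k, 'x) ring_scheme \<Rightarrow> ('k, 'v, 'y) module_scheme \<Rightarrow> 'v topology" where
  "zariski_topology K V =
     (let B = (SOME B. finite B \<and> vectorspace.basis K V B) in
      topology_of_closed (carrier V)
        {zariski_zero_set K V B F | F. F \<subseteq> ring.indexed_pset K B (carrier K)})"

definition residue_topology ::
  "('r, 'x) ring_scheme \<Rightarrow> ('r, 'm, 'y) module_scheme \<Rightarrow> 'r set \<Rightarrow> 'm set topology" where
  "residue_topology R M \<mm> = (let V = residue_module R M \<mm> in
     if \<mm> \<in> S_set R M then zariski_topology (R Quot \<mm>) V
     else topology_of_closed (carrier V) {{}, {\<zero>\<^bsub>V\<^esub>}, carrier V})"

definition residue_product ::
  "('r, 'x) ring_scheme \<Rightarrow> ('r, 'm, 'y) module_scheme \<Rightarrow> ('r set \<Rightarrow> 'm set) topology" where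
  "residue_product R M = product_topology (residue_topology R M) (mSpec R)"

definition q_map ::
  "('r, 'x) ring_scheme \<Rightarrow> ('r, 'm, 'y) module_scheme \<Rightarrow> 'm \<Rightarrow> ('r set \<Rightarrow> 'm set)" where
  "q_map R M x = (\<lambda>\<mm>\<in>mSpec R. ideal_smult R M \<mm> +>\<^bsub>M\<^esub> x)"

definition induced_zariski ::
  "('r, 'x) ring_scheme \<Rightarrow> ('r, 'm, 'y) module_scheme \<Rightarrow> 'm topology" where
  "induced_zariski R M = pullback_topology (carrier M) (q_map R M) (residue_product R M)"

text \<open>
  Cardinals are cardinal orders, compared by \<^const>\<open>ordIso\<close> and \<^const>\<open>ordLeq\<close>. The minimum of
  the empty set is set to the cardinal \<open>0\<close>; in particular \<open>sigma\<close> and \<open>sigma_tau\<close> below can only be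
  a nonzero cardinal if a covering of the required kind exists.
\<close>
definition min_card :: "'a rel set \<Rightarrow> 'a rel" where
  "min_card \<K> = (if \<K> = {} then |{}| else (SOME k. k \<in> \<K> \<and> (\<forall>k'\<in>\<K>. k \<le>o k')))"

definition sigma :: "('r, 'x) ring_scheme \<Rightarrow> ('r, 'm, 'y) module_scheme \<Rightarrow> 'm set rel" where
  "sigma R M = min_card {|\<F>| | \<F>.
     (\<forall>N\<in>\<F>. Module.submodule N R M \<and> N \<noteq> carrier M) \<and> \<Union>\<F> = carrier M}"

definition sigma_tau :: "('r, 'x) ring_scheme \<Rightarrow> ('r, 'm, 'y) module_scheme \<Rightarrow> 'm set rel" where
  "sigma_tau R M = min_card {|\<F>| | \<F>.
     (\<forall>C\<in>\<F>. closedin (induced_zariski R M) C \<and> C \<noteq> carrier M) \<and> \<Union>\<F> = carrier M}"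

definition kappa :: "('r, 'x) ring_scheme \<Rightarrow> ('r, 'm, 'y) module_scheme \<Rightarrow> ('r set + unit) rel" where
  "kappa R M = min_card {|carrier (R Quot \<mm>)| | \<mm>. \<mm> \<in> S_set R M} +c cone"

definition nowhere_dense :: "'a topology \<Rightarrow> 'a set \<Rightarrow> bool" where
  "nowhere_dense T A \<longleftrightarrow> A \<subseteq> topspace T \<and> Abstract_Topology.interior_of T (Abstract_Topology.closure_of T A) = {}"

definition first_category :: "'k rel \<Rightarrow> 'a topology \<Rightarrow> bool" where
  "first_category k T \<longleftrightarrow>
     (\<exists>\<A>. |\<A>| <o k \<and> (\<forall>A\<in>\<A>. nowhere_dense T A) \<and> \<Union>\<A> = topspace T)"

end

theory Submission
  imports Defs
begin

text \<open>
  Three comparisons close a circle: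
  \<open>sigma \<le> kappa \<le> sigma_tau \<le> sigma\<close>.
  Write \<open>V\<close> for a residue module \<open>M/\<mm>M\<close> and \<open>K\<close> for \<open>R/\<mm>\<close>.

  \<^item> \<open>sigma \<le> kappa\<close>. Let \<open>\<mm>\<close> in \<open>S_set R M\<close> have the least residue field \<open>K\<close>. As \<open>K\<close> is
    infinite, \<open>kappa\<close> is just the cardinality of \<open>K\<close>. Two coordinates on \<open>V\<close> give the pencil of
    hyperplanes \<open>r c\<^sub>1 + s c\<^sub>2 = 0\<close>, one for each point of the projective line over \<open>K\<close>. The pencil
    covers \<open>V\<close>, and the preimages of its members cover \<open>M\<close> (\<open>cover_by_proper_submodules\<close>).

  \<^item> \<open>sigma_tau \<le> sigma\<close>. Every proper submodule lies in a maximal one, \<open>L\<close> say, because \<open>M\<close> is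
    finitely generated. The quotient \<open>M/L\<close> is simple, hence isomorphic to some \<open>R/\<mm>\<close>, so \<open>L\<close> is the
    preimage of the kernel of a nonzero linear functional on \<open>V\<close>. This kernel is the zero set of a
    linear form if \<open>V\<close> carries the Zariski topology, and it is \<open>{0}\<close> if \<open>dim V \<le> 1\<close>; either way it is
    closed (\<open>maximal_submodule_is_preimage_of_closed\<close>). So a cover by proper submodules can be enlarged,
    member by member, to a cover by proper closed sets.

  \<^item> \<open>kappa \<le> sigma_tau\<close>. Each \<open>V\<close> is an irreducible space. In the Zariski case this is because,
    over an infinite field, two polynomial functions that do not vanish identically have a common
    nonzero; in the coarse case the nonempty open sets are nested. By the Chinese remainder theorem the image
    of \<open>M\<close> meets every basic open set of the product, so it is irreducible as well, and therefore
    all its proper closed subsets are nowhere dense. Fewer than \<open>kappa\<close> proper closed sets covering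
    \<open>M\<close> would thus make the image of first category (\<open>q_map_image_nowhere_dense\<close>).
\<close>


section \<open>Irreducible topological spaces and least cardinals\<close>

text \<open>
  The family is only asked to be closed under intersections of nonempty subfamilies; the empty
  intersection is accounted for by \<open>V \<in> \<C>\<close>.
\<close>
lemma topology_of_closed_family:
  assumes empty: "{} \<in> \<C>" and whole: "V \<in> \<C>" and sub: "\<And>C. C \<in> \<C> \<Longrightarrow> C \<subseteq> V"
    and un: "\<And>A B. A \<in> \<C> \<Longrightarrow> B \<in> \<C> \<Longrightarrow> A \<union> B \<in> \<C>"
    and int: "\<And>\<K>. \<K> \<subseteq> \<C> \<Longrightarrow> \<K> \<noteq> {} \<Longrightarrow> \<Inter>\<K> \<in> \<C>"
  shows openin_topology_of_closed:
      "openin (topology_of_closed V \<C>) U \<longleftrightarrow> (\<exists>C\<in>\<C>. U = V - C)"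
    and topspace_topology_of_closed: "topspace (topology_of_closed V \<C>) = V"
    and closedin_topology_of_closed: "closedin (topology_of_closed V \<C>) A \<longleftrightarrow> A \<in> \<C>"
proof -
  have "istopology (\<lambda>U. \<exists>C\<in>\<C>. U = V - C)"
    unfolding istopology_def
  proof (intro conjI allI impI)
    fix U W assume "\<exists>C\<in>\<C>. U = V - C" "\<exists>C\<in>\<C>. W = V - C"
    then obtain C D where "C \<in> \<C>" "D \<in> \<C>" "U = V - C" "W = V - D" by auto
    then show "\<exists>C\<in>\<C>. U \<inter> W = V - C" using un by (intro bexI[of _ "C \<union> D"]) auto
  next
    fix \<K> assume *: "\<forall>U\<in>\<K>. \<exists>C\<in>\<C>. U = V - C"
    show "\<exists>C\<in>\<C>. \<Union>\<K> = V - C"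
    proof (cases "\<K> = {}")
      case True
      then show ?thesis using whole by auto
    next
      case False
      have "V - U \<in> \<C>" if "U \<in> \<K>" for U
      proof -
        from * that obtain C where "C \<in> \<C>" "U = V - C" by blast
        moreover from this have "V - U = C" using sub by blast
        ultimately show ?thesis by simp
      qed
      then have "\<Inter>((\<lambda>U. V - U) ` \<K>) \<in> \<C>" using False by (intro int) auto
      moreover have "\<Union>\<K> = V - \<Inter>((\<lambda>U. V - U) ` \<K>)" using * False by auto
      ultimately show ?thesis by blast
    qed
  qed
  then show o: "openin (topology_of_closed V \<C>) U \<longleftrightarrow> (\<exists>C\<in>\<C>. U = V - C)" for U
    unfolding topology_of_closed_def by (simp add: topology_inverse')
  show t: "topspace (topology_of_closed V \<C>) = V"
    unfolding topspace_def o using empty by auto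
  show "closedin (topology_of_closed V \<C>) A \<longleftrightarrow> A \<in> \<C>"
    unfolding closedin_def o t using sub by (metis Diff_Diff_Int Int_absorb1 double_diff subset_refl)
qed

text \<open>
  The empty space is counted as irreducible, contrary to the convention of algebraic geometry.
\<close>
definition irreducible_space :: "'a topology \<Rightarrow> bool" where
  "irreducible_space T \<longleftrightarrow>
     (\<forall>U W. openin T U \<and> openin T W \<and> U \<noteq> {} \<and> W \<noteq> {} \<longrightarrow> U \<inter> W \<noteq> {})"

text \<open>
  The interior of a proper closed set is an open set disjoint from its nonempty open complement.
\<close>
lemma irreducible_space_closedin_nowhere_dense:
  assumes irr: "irreducible_space T" and C: "closedin T C" "C \<noteq> topspace T"
  shows "nowhere_dense T C"
proof -
  let ?U = "Abstract_Topology.interior_of T C" and ?W = "topspace T - C"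
  have "?W \<noteq> {}" "openin T ?W" using C closedin_subset by (auto simp: closedin_def)
  moreover have "?U \<inter> ?W = {}" using interior_of_subset[of T C] by auto
  ultimately have "?U = {}"
    using irr openin_interior_of[of T C] unfolding irreducible_space_def by blast
  moreover have "Abstract_Topology.closure_of T C = C" using C(1) by (rule closure_of_closedin)
  ultimately show ?thesis using closedin_subset[OF C(1)] by (simp add: nowhere_dense_def)
qed

text \<open>
  Two basic open sets of the product restrict only finitely many coordinates. On these coordinates
  the irreducibility of the factors gives a common prescription, and the density assumption finds a
  point of \<open>D\<close> that obeys it.
\<close>
lemma irreducible_space_dense_in_product:
  assumes irr: "\<And>i. i \<in> I \<Longrightarrow> irreducible_space (T i)"
    and D: "D \<subseteq> topspace (product_topology T I)"
    and dense: "\<And>F x. finite F \<Longrightarrow> F \<subseteq> I \<Longrightarrow> (\<And>i. i \<in> F \<Longrightarrow> x i \<in> topspace (T i)) \<Longrightarrow>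
      \<exists>d\<in>D. \<forall>i\<in>F. d i = x i"
  shows "irreducible_space (subtopology (product_topology T I) D)"
  unfolding irreducible_space_def
proof (intro allI impI, elim conjE)
  fix U W
  assume "openin (subtopology (product_topology T I) D) U"
    "openin (subtopology (product_topology T I) D) W" and ne: "U \<noteq> {}" "W \<noteq> {}"
  then obtain U' W' where U': "openin (product_topology T I) U'" "U = U' \<inter> D"
    and W': "openin (product_topology T I) W'" "W = W' \<inter> D"
    by (auto simp: openin_subtopology)
  obtain u w where u: "u \<in> U'" and w: "w \<in> W'" using ne U' W' by auto
  obtain A where A: "finite {i \<in> I. A i \<noteq> topspace (T i)}" "\<forall>i\<in>I. openin (T i) (A i)"
    "u \<in> Pi\<^sub>E I A" "Pi\<^sub>E I A \<subseteq> U'"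
    using bspec[OF U'(1)[unfolded openin_product_topology_alt] u] by (elim exE conjE) (rule that)
  obtain B where B: "finite {i \<in> I. B i \<noteq> topspace (T i)}" "\<forall>i\<in>I. openin (T i) (B i)"
    "w \<in> Pi\<^sub>E I B" "Pi\<^sub>E I B \<subseteq> W'"
    using bspec[OF W'(1)[unfolded openin_product_topology_alt] w] by (elim exE conjE) (rule that)
  define F where "F = {i \<in> I. A i \<noteq> topspace (T i)} \<union> {i \<in> I. B i \<noteq> topspace (T i)}"
  have F: "finite F" "F \<subseteq> I" using A B by (auto simp: F_def)
  have "\<exists>y. y \<in> A i \<inter> B i" if "i \<in> I" for i
  proof -
    have "u i \<in> A i" "w i \<in> B i" using A(3) B(3) that by (auto simp: PiE_iff)
    then have "A i \<inter> B i \<noteq> {}"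
      using irr[OF that] A(2) B(2) that unfolding irreducible_space_def by blast
    then show ?thesis by blast
  qed
  then obtain x where x: "\<And>i. i \<in> I \<Longrightarrow> x i \<in> A i \<inter> B i" by metis
  then have "\<And>i. i \<in> F \<Longrightarrow> x i \<in> topspace (T i)" using F A(2) openin_subset by blast
  with dense[OF F] obtain d where d: "d \<in> D" "\<forall>i\<in>F. d i = x i" by blast
  have dt: "d \<in> (\<Pi>\<^sub>E i\<in>I. topspace (T i))" using d D by auto
  have "d i \<in> A i \<inter> B i" if "i \<in> I" for i
  proof (cases "i \<in> F")
    case True
    then show ?thesis using d x that by simp
  next
    case False
    then show ?thesis using dt that by (auto simp: F_def)
  qed
  then have "d \<in> Pi\<^sub>E I A" "d \<in> Pi\<^sub>E I B" using dt by (auto simp: PiE_iff)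
  then have "d \<in> U' \<inter> D \<inter> (W' \<inter> D)" using A(4) B(4) d(1) by blast
  then show "U \<inter> W \<noteq> {}" using U'(2) W'(2) by blast
qed

lemma min_card:
  assumes "\<K> \<noteq> {}" "\<And>k. k \<in> \<K> \<Longrightarrow> Card_order k"
  shows min_card_in: "min_card \<K> \<in> \<K>" and min_card_le: "\<And>k. k \<in> \<K> \<Longrightarrow> min_card \<K> \<le>o k"
proof -
  have "\<exists>k. k \<in> \<K> \<and> (\<forall>k'\<in>\<K>. k \<le>o k')" using exists_minim_Card_order[of \<K>] assms by blast
  from someI_ex[OF this] assms(1)
  show "min_card \<K> \<in> \<K>" "\<And>k. k \<in> \<K> \<Longrightarrow> min_card \<K> \<le>o k" by (auto simp: min_card_def)
qed

text \<open>
  Adding one to an infinite cardinal does not change it, so the minimum is attained by a residue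
  field of cardinality \<open>kappa R M\<close>.
\<close>
lemma kappa_ordIso:
  assumes "S_set R M \<noteq> {}" and "\<And>\<mm>. \<mm> \<in> S_set R M \<Longrightarrow> infinite (carrier (R Quot \<mm>))"
  shows "\<exists>\<mm>\<in>S_set R M. kappa R M =o |carrier (R Quot \<mm>)|"
proof -
  let ?K = "{|carrier (R Quot \<mm>)| | \<mm>. \<mm> \<in> S_set R M}"
  have "min_card ?K \<in> ?K" by (rule min_card_in) (use assms card_of_Card_order in auto)
  then obtain \<mm> where m: "\<mm> \<in> S_set R M" "min_card ?K = |carrier (R Quot \<mm>)|" by auto
  have inf: "infinite (carrier (R Quot \<mm>))" using assms(2) m(1) .
  then have ci: "Cinfinite |carrier (R Quot \<mm>)|"
    by (simp add: cinfinite_def Field_card_of card_of_card_order_on)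
  have "cone \<le>o |carrier (R Quot \<mm>)|"
    by (rule cone_ordLeq_Cnotzero) (rule Cinfinite_Cnotzero[OF ci])
  then have "|carrier (R Quot \<mm>)| +c cone =o |carrier (R Quot \<mm>)|"
    by (rule csum_absorb1[OF ci])
  then show ?thesis using m by (auto simp: kappa_def)
qed

section \<open>Evaluation of polynomials in indexed variables\<close>

abbreviation monomial_eval :: "('k, 'x) ring_scheme \<Rightarrow> 'i multiset \<Rightarrow> ('i \<Rightarrow> 'k) \<Rightarrow> 'k" where
  "monomial_eval K m c \<equiv> (\<Otimes>\<^bsub>K\<^esub>i\<in>set_mset m. c i [^]\<^bsub>K\<^esub> count m i)"

context cring
begin

lemma indexed_pset_support:
  assumes "P \<in> indexed_pset I (carrier R)"
  shows "finite {m. P m \<noteq> \<zero>} \<and> (\<forall>m. P m \<in> carrier R) \<and> (\<forall>m. P m \<noteq> \<zero> \<longrightarrow> set_mset m \<subseteq> I)"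
  using assms
proof induction
  case (indexed_const k)
  have "{m. indexed_const k m \<noteq> \<zero>} \<subseteq> {{#}}" by (auto simp: indexed_const_def)
  then show ?case using indexed_const by (auto simp: indexed_const_def intro: finite_subset)
next
  case (indexed_padd P Q)
  have "{m. indexed_padd P Q m \<noteq> \<zero>} \<subseteq> {m. P m \<noteq> \<zero>} \<union> {m. Q m \<noteq> \<zero>}"
    by (auto simp: indexed_padd_def)
  with indexed_padd show ?case
    by (auto simp: indexed_padd_def intro: finite_subset) (metis l_zero subsetD zero_closed)
next
  case (indexed_pmult P i)
  have "{m. indexed_pmult P i m \<noteq> \<zero>} \<subseteq> (\<lambda>m. m + {#i#}) ` {m. P m \<noteq> \<zero>}"
    unfolding indexed_pmult_def by (auto split: if_splits) (metis (mono_tags, lifting) add_mset_add_single imageI insert_DiffM2 mem_Collect_eq)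
  moreover have "set_mset m \<subseteq> I" if "indexed_pmult P i m \<noteq> \<zero>" for m
  proof -
    from that have "i \<in># m" "P (m - {#i#}) \<noteq> \<zero>" by (auto simp: indexed_pmult_def split: if_splits)
    then have "set_mset (m - {#i#}) \<subseteq> I" using indexed_pmult by blast
    moreover have "set_mset m = insert i (set_mset (m - {#i#}))" using \<open>i \<in># m\<close>
      by (metis insert_DiffM set_mset_add_mset_insert)
    ultimately show ?thesis using indexed_pmult by auto
  qed
  moreover have "\<forall>m. indexed_pmult P i m \<in> carrier R"
    using indexed_pmult by (auto simp: indexed_pmult_def)
  moreover have "finite ((\<lambda>m. m + {#i#}) ` {m. P m \<noteq> \<zero>})" using indexed_pmult by simp
  ultimately show ?case using finite_subset by blast
qed

lemma monomial_eval_closed: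
  "c \<in> set_mset m \<rightarrow> carrier R \<Longrightarrow> monomial_eval R m c \<in> carrier R"
  by (auto intro!: finprod_closed nat_pow_closed)

lemma monomial_eval_add:
  assumes c: "c \<in> insert i (set_mset m) \<rightarrow> carrier R"
  shows "monomial_eval R (add_mset i m) c = c i \<otimes> monomial_eval R m c"
proof -
  let ?f = "\<lambda>j. c j [^] count (add_mset i m) j" and ?g = "\<lambda>j. c j [^] count m j"
  let ?A = "set_mset m - {i}"
  have ins: "insert i (set_mset m) = insert i ?A" by auto
  have cA: "c \<in> ?A \<rightarrow> carrier R" "c i \<in> carrier R" using c by auto
  have l: "finprod R ?f (set_mset (add_mset i m)) = c i [^] Suc (count m i) \<otimes> finprod R ?f ?A"
    unfolding set_mset_add_mset_insert ins using cA by (subst finprod_insert) auto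
  have "finprod R ?f ?A = finprod R ?g ?A"
    using cA by (intro finprod_cong') auto
  moreover have "monomial_eval R m c = c i [^] count m i \<otimes> finprod R ?g ?A"
  proof (cases "i \<in># m")
    case True
    then have "set_mset m = insert i ?A" by auto
    then show ?thesis using cA by (metis (no_types, lifting) DiffD2 finite_Diff finite_set_mset finprod_insert insertI1 nat_pow_closed Pi_I Pi_mem)
  next
    case False
    then have "count m i = 0" "?A = set_mset m" by (auto simp: count_eq_zero_iff)
    then show ?thesis using cA by (auto intro!: finprod_closed[THEN l_one, symmetric])
  qed
  moreover have "finprod R ?g ?A \<in> carrier R" using cA by (auto intro!: finprod_closed)
  ultimately show ?thesis using l cA by (simp add: m_ac)
qed

text \<open>
  Evaluation sums over the support of a polynomial, which changes under every operation. Summing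
  over a larger finite set allows two polynomials to be compared term by term.
\<close>
lemma indexed_poly_eval_superset:
  assumes P: "P \<in> indexed_pset I (carrier R)" and c: "c \<in> I \<rightarrow> carrier R"
    and S: "finite S" "{m. P m \<noteq> \<zero>} \<subseteq> S" "\<And>m. m \<in> S \<Longrightarrow> set_mset m \<subseteq> I"
  shows "indexed_poly_eval R P c = (\<Oplus>m\<in>S. P m \<otimes> monomial_eval R m c)"
proof -
  note s = indexed_pset_support[OF P]
  have cl: "monomial_eval R m c \<in> carrier R" if "m \<in> S" for m
    by (intro monomial_eval_closed) (use c S(3)[OF that] in auto)
  show ?thesis unfolding indexed_poly_eval_def
    by (rule add.finprod_mono_neutral_cong_left) (use S s cl in auto)
qed

lemma indexed_poly_eval_closed:
  assumes P: "P \<in> indexed_pset I (carrier R)" and c: "c \<in> I \<rightarrow> carrier R"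
  shows "indexed_poly_eval R P c \<in> carrier R"
proof -
  note s = indexed_pset_support[OF P]
  have "monomial_eval R m c \<in> carrier R" if "P m \<noteq> \<zero>" for m
    proof (rule monomial_eval_closed)
    have "set_mset m \<subseteq> I" using s that by blast
    then show "c \<in> set_mset m \<rightarrow> carrier R" using c by blast
  qed
  then show ?thesis unfolding indexed_poly_eval_def
    by (intro finsum_closed) (use s in auto)
qed

lemma indexed_poly_eval_cong:
  assumes P: "P \<in> indexed_pset I (carrier R)" and c: "c \<in> I \<rightarrow> carrier R"
    and "\<And>i. i \<in> I \<Longrightarrow> c i = d i"
  shows "indexed_poly_eval R P c = indexed_poly_eval R P d"
proof -
  note s = indexed_pset_support[OF P]
  have "monomial_eval R m c = monomial_eval R m d" if "P m \<noteq> \<zero>" for m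
  proof (rule finprod_cong')
    show "(\<lambda>i. d i [^] count m i) \<in> set_mset m \<rightarrow> carrier R"
    proof (rule Pi_I)
      fix i assume "i \<in># m"
      then have "i \<in> I" using s that by blast
      then show "d i [^] count m i \<in> carrier R" using assms(2) assms(3)[of i, symmetric] by auto
    qed
    show "c i [^] count m i = d i [^] count m i" if "i \<in># m" for i
    proof -
      have "i \<in> I" using s \<open>P m \<noteq> \<zero>\<close> that by blast
      then show ?thesis using assms(3) by simp
    qed
  qed simp
  moreover have "monomial_eval R m d \<in> carrier R" if "P m \<noteq> \<zero>" for m
    proof (rule monomial_eval_closed)
    have "set_mset m \<subseteq> I" using s that by blast
    moreover have "d \<in> I \<rightarrow> carrier R" using c assms(3) by (metis Pi_cong)
    ultimately show "d \<in> set_mset m \<rightarrow> carrier R" by blast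
  qed
  ultimately show ?thesis unfolding indexed_poly_eval_def
    by (intro finsum_cong') (use s in auto)
qed

lemma indexed_poly_eval_const:
  fixes c :: "'i \<Rightarrow> 'a"
  assumes "k \<in> carrier R"
  shows "indexed_poly_eval R (indexed_const k) c = k"
proof (cases "k = \<zero>")
  case True
  then show ?thesis by (simp add: indexed_poly_eval_def indexed_const_def)
next
  case False
  then have "{m :: 'i multiset. indexed_const k m \<noteq> \<zero>} = {{#}}" by (auto simp: indexed_const_def)
  moreover have "indexed_const k ({#} :: 'i multiset) = k" by (simp add: indexed_const_def)
  ultimately show ?thesis using assms unfolding indexed_poly_eval_def by simp
qed

lemma indexed_poly_eval_padd:
  assumes P: "P \<in> indexed_pset I (carrier R)" and Q: "Q \<in> indexed_pset I (carrier R)"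
    and c: "c \<in> I \<rightarrow> carrier R"
  shows "indexed_poly_eval R (indexed_padd P Q) c
    = indexed_poly_eval R P c \<oplus> indexed_poly_eval R Q c"
proof -
  note sP = indexed_pset_support[OF P] and sQ = indexed_pset_support[OF Q]
  let ?S = "{m. P m \<noteq> \<zero>} \<union> {m. Q m \<noteq> \<zero>}"
  have S: "finite ?S" "\<And>m. m \<in> ?S \<Longrightarrow> set_mset m \<subseteq> I" using sP sQ by auto
  have cl: "monomial_eval R m c \<in> carrier R" if "m \<in> ?S" for m
    by (intro monomial_eval_closed) (use c S(2)[OF that] in auto)
  have "indexed_poly_eval R (indexed_padd P Q) c
      = (\<Oplus>m\<in>?S. indexed_padd P Q m \<otimes> monomial_eval R m c)"
    by (rule indexed_poly_eval_superset[OF indexed_pset.indexed_padd[OF P Q] c S(1) _ S(2)])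
       (auto simp: indexed_padd_def)
  also have "\<dots> = (\<Oplus>m\<in>?S. P m \<otimes> monomial_eval R m c \<oplus> Q m \<otimes> monomial_eval R m c)"
    by (rule finsum_cong') (use sP sQ cl in \<open>auto simp: indexed_padd_def l_distr\<close>)
  also have "\<dots> = (\<Oplus>m\<in>?S. P m \<otimes> monomial_eval R m c) \<oplus> (\<Oplus>m\<in>?S. Q m \<otimes> monomial_eval R m c)"
    by (rule finsum_addf) (use sP sQ cl in auto)
  also have "\<dots> = indexed_poly_eval R P c \<oplus> indexed_poly_eval R Q c"
    using indexed_poly_eval_superset[OF P c S(1) _ S(2)] indexed_poly_eval_superset[OF Q c S(1) _ S(2)]
    by auto
  finally show ?thesis .
qed

lemma indexed_poly_eval_pmult:
  assumes P: "P \<in> indexed_pset I (carrier R)" and i: "i \<in> I"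
    and c: "c \<in> I \<rightarrow> carrier R"
  shows "indexed_poly_eval R (indexed_pmult P i) c = c i \<otimes> indexed_poly_eval R P c"
proof -
  note sP = indexed_pset_support[OF P]
  let ?S = "{m. P m \<noteq> \<zero>}"
  have S: "finite ?S" "\<And>m. m \<in> ?S \<Longrightarrow> set_mset m \<subseteq> I" using sP by auto
  have cl: "monomial_eval R m c \<in> carrier R" if "m \<in> ?S" for m
    by (intro monomial_eval_closed) (use c S(2)[OF that] in auto)
  have ci: "c i \<in> carrier R" using c i by auto
  have cl': "c \<in> insert i (set_mset m) \<rightarrow> carrier R" if "m \<in> ?S" for m
    using S(2)[OF that] c i by blast
  have sup: "m \<in> add_mset i ` ?S" if "indexed_pmult P i m \<noteq> \<zero>" for m
  proof
    from that have "i \<in># m" "P (m - {#i#}) \<noteq> \<zero>" by (auto simp: indexed_pmult_def split: if_splits)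
    then show "m = add_mset i (m - {#i#})" "m - {#i#} \<in> ?S" by auto
  qed
  have "indexed_poly_eval R (indexed_pmult P i) c
      = (\<Oplus>m\<in>add_mset i ` ?S. indexed_pmult P i m \<otimes> monomial_eval R m c)"
    by (rule indexed_poly_eval_superset[OF indexed_pset.indexed_pmult[OF P i] c])
       (use S i sup in \<open>fastforce+\<close>)
  also have "\<dots> = (\<Oplus>m\<in>?S. indexed_pmult P i (add_mset i m) \<otimes> monomial_eval R (add_mset i m) c)"
  proof (rule add.finprod_reindex)
    show "(\<lambda>m. indexed_pmult P i m \<otimes> monomial_eval R m c) \<in> add_mset i ` ?S \<rightarrow> carrier R"
    proof (rule Pi_I)
      fix m assume "m \<in> add_mset i ` ?S"
      then have "monomial_eval R m c \<in> carrier R"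
        by (intro monomial_eval_closed) (use cl' in fastforce)
      then show "indexed_pmult P i m \<otimes> monomial_eval R m c \<in> carrier R"
        using sP by (simp add: indexed_pmult_def)
    qed
  qed (auto simp: inj_on_def)
  also have "\<dots> = (\<Oplus>m\<in>?S. c i \<otimes> (P m \<otimes> monomial_eval R m c))"
  proof (rule finsum_cong')
    fix m assume m: "m \<in> ?S"
    then have "monomial_eval R (add_mset i m) c = c i \<otimes> monomial_eval R m c"
      by (intro monomial_eval_add cl')
    moreover have "indexed_pmult P i (add_mset i m) = P m" by (simp add: indexed_pmult_def)
    ultimately show "indexed_pmult P i (add_mset i m) \<otimes> monomial_eval R (add_mset i m) c
        = c i \<otimes> (P m \<otimes> monomial_eval R m c)"
      using cl[OF m] ci sP by (simp add: m_ac)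
  qed (use cl ci sP in auto)
  also have "\<dots> = c i \<otimes> (\<Oplus>m\<in>?S. P m \<otimes> monomial_eval R m c)"
    by (rule finsum_rdistr[symmetric]) (use cl ci sP S in auto)
  finally show ?thesis by (simp add: indexed_poly_eval_def)
qed

text \<open>
  The inductive set of polynomials is generated by constants, sums and multiplications by a single
  variable. General products are obtained from these up to evaluation, which is all that zero sets
  depend on. The induction is on \<open>P\<close>, with an inner induction on \<open>Q\<close> if \<open>P\<close> is constant.
\<close>
lemma indexed_poly_product:
  assumes P: "P \<in> indexed_pset I (carrier R)" and Q: "Q \<in> indexed_pset I (carrier R)"
  shows "\<exists>S \<in> indexed_pset I (carrier R). \<forall>c \<in> I \<rightarrow> carrier R.
    indexed_poly_eval R S c = indexed_poly_eval R P c \<otimes> indexed_poly_eval R Q c"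
  using P
proof induction
  case (indexed_const k)
  show ?case using Q
  proof induction
    case (indexed_const l)
    show ?case using indexed_const \<open>k \<in> carrier R\<close>
      by (intro bexI[of _ "indexed_const (k \<otimes> l)"])
         (auto simp: indexed_poly_eval_const intro: indexed_pset.indexed_const)
  next
    case (indexed_padd Q Q')
    then obtain S S' where "S \<in> indexed_pset I (carrier R)" "S' \<in> indexed_pset I (carrier R)"
      "\<forall>c \<in> I \<rightarrow> carrier R. indexed_poly_eval R S c = indexed_poly_eval R (indexed_const k) c \<otimes> indexed_poly_eval R Q c"
      "\<forall>c \<in> I \<rightarrow> carrier R. indexed_poly_eval R S' c = indexed_poly_eval R (indexed_const k) c \<otimes> indexed_poly_eval R Q' c"
      by auto
    then show ?case using indexed_padd \<open>k \<in> carrier R\<close>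
      by (intro bexI[of _ "indexed_padd S S'"])
         (auto simp: indexed_poly_eval_padd indexed_poly_eval_const r_distr indexed_poly_eval_closed intro: indexed_pset.indexed_padd)
  next
    case (indexed_pmult Q i)
    then obtain S where S: "S \<in> indexed_pset I (carrier R)"
      "\<forall>c \<in> I \<rightarrow> carrier R. indexed_poly_eval R S c = indexed_poly_eval R (indexed_const k) c \<otimes> indexed_poly_eval R Q c"
      by auto
    show ?case
    proof (intro bexI ballI)
      show "indexed_pmult S i \<in> indexed_pset I (carrier R)"
        using S indexed_pmult by (auto intro: indexed_pset.indexed_pmult)
      fix c assume c: "c \<in> I \<rightarrow> carrier R"
      then have "c i \<in> carrier R" using indexed_pmult by auto
      then show "indexed_poly_eval R (indexed_pmult S i) c = indexed_poly_eval R (indexed_const k) c \<otimes> indexed_poly_eval R (indexed_pmult Q i) c"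
        using indexed_pmult S c \<open>k \<in> carrier R\<close> 
        by (simp add: indexed_poly_eval_pmult indexed_poly_eval_const indexed_poly_eval_closed[OF _ c] m_ac)
    qed
  qed
next
  case (indexed_padd P P')
  then obtain S S' where "S \<in> indexed_pset I (carrier R)" "S' \<in> indexed_pset I (carrier R)"
    "\<forall>c \<in> I \<rightarrow> carrier R. indexed_poly_eval R S c = indexed_poly_eval R P c \<otimes> indexed_poly_eval R Q c"
    "\<forall>c \<in> I \<rightarrow> carrier R. indexed_poly_eval R S' c = indexed_poly_eval R P' c \<otimes> indexed_poly_eval R Q c"
    by auto
  then show ?case using indexed_padd Q
    by (intro bexI[of _ "indexed_padd S S'"])
       (auto simp: indexed_poly_eval_padd l_distr indexed_poly_eval_closed intro: indexed_pset.indexed_padd)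
next
  case (indexed_pmult P i)
  then obtain S where S: "S \<in> indexed_pset I (carrier R)"
    "\<forall>c \<in> I \<rightarrow> carrier R. indexed_poly_eval R S c = indexed_poly_eval R P c \<otimes> indexed_poly_eval R Q c"
    by auto
  show ?case
  proof (intro bexI ballI)
    show "indexed_pmult S i \<in> indexed_pset I (carrier R)"
      using S indexed_pmult by (auto intro: indexed_pset.indexed_pmult)
    fix c assume c: "c \<in> I \<rightarrow> carrier R"
    then have "c i \<in> carrier R" using indexed_pmult by auto
    then show "indexed_poly_eval R (indexed_pmult S i) c = indexed_poly_eval R (indexed_pmult P i) c \<otimes> indexed_poly_eval R Q c"
      using indexed_pmult S c Q
      by (simp add: indexed_poly_eval_pmult indexed_poly_eval_closed[OF _ c] m_ac)
  qed
qed

lemma linear_form_indexed_poly: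
  assumes "finite J" "J \<subseteq> I" "r \<in> J \<rightarrow> carrier R"
  shows "\<exists>P \<in> indexed_pset I (carrier R). \<forall>c \<in> I \<rightarrow> carrier R.
    indexed_poly_eval R P c = (\<Oplus>i\<in>J. c i \<otimes> r i)"
  using assms
proof induction
  case empty
  show ?case by (intro bexI[of _ "indexed_const \<zero>"])
      (auto simp: indexed_poly_eval_const intro: indexed_pset.indexed_const)
next
  case (insert j J)
  then obtain P where P: "P \<in> indexed_pset I (carrier R)"
    "\<And>c. c \<in> I \<rightarrow> carrier R \<Longrightarrow> indexed_poly_eval R P c = (\<Oplus>i\<in>J. c i \<otimes> r i)" by auto
  let ?Q = "indexed_pmult (indexed_const (r j)) j"
  have j: "r j \<in> carrier R" "j \<in> I" using insert by auto
  have K: "indexed_const (r j) \<in> indexed_pset I (carrier R)"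
    using j by (auto intro: indexed_pset.indexed_const)
  have Q: "?Q \<in> indexed_pset I (carrier R)"
    using K j by (auto intro: indexed_pset.indexed_pmult)
  show ?case
  proof (intro bexI ballI)
    show "indexed_padd ?Q P \<in> indexed_pset I (carrier R)"
      using P Q by (auto intro: indexed_pset.indexed_padd)
    fix c assume c: "c \<in> I \<rightarrow> carrier R"
    then have "(\<Oplus>i\<in>insert j J. c i \<otimes> r i) = c j \<otimes> r j \<oplus> (\<Oplus>i\<in>J. c i \<otimes> r i)"
      by (intro finsum_insert) (use insert in \<open>auto simp: Pi_iff subset_iff\<close>)
    then show "indexed_poly_eval R (indexed_padd ?Q P) c = (\<Oplus>i\<in>insert j J. c i \<otimes> r i)"
      using P c j by (simp add: indexed_poly_eval_padd[OF Q _ c] indexed_poly_eval_pmult[OF K]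
          indexed_poly_eval_const)
  qed
qed

end

context field
begin

text \<open>
  Restricted to a parametrised line, a polynomial in many variables becomes a polynomial in the
  parameter. This reduces questions about zeros to the finiteness of the set of roots.
\<close>
lemma indexed_poly_on_line:
  assumes P: "P \<in> indexed_pset I (carrier R)"
    and a: "a \<in> I \<rightarrow> carrier R" and d: "d \<in> I \<rightarrow> carrier R"
  shows "\<exists>p \<in> carrier (poly_ring R). \<forall>t \<in> carrier R.
    eval p t = indexed_poly_eval R P (\<lambda>i. a i \<oplus> t \<otimes> d i)"
  using P
proof induction
  case (indexed_const k)
  interpret UP: domain "poly_ring R" by (rule univ_poly_is_domain[OF carrier_is_subring])
  show ?case
  proof (intro bexI ballI)
    show "(if k = \<zero> then [] else [k]) \<in> carrier (poly_ring R)"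
      using indexed_const by (auto simp: univ_poly_carrier[symmetric] polynomial_def)
  qed (use indexed_const in \<open>auto simp: indexed_poly_eval_const\<close>)
next
  case (indexed_padd P Q)
  interpret UP: domain "poly_ring R" by (rule univ_poly_is_domain[OF carrier_is_subring])
  from indexed_padd obtain p q where p: "p \<in> carrier (poly_ring R)" "q \<in> carrier (poly_ring R)"
    "\<forall>t\<in>carrier R. eval p t = indexed_poly_eval R P (\<lambda>i. a i \<oplus> t \<otimes> d i)"
    "\<forall>t\<in>carrier R. eval q t = indexed_poly_eval R Q (\<lambda>i. a i \<oplus> t \<otimes> d i)" by auto
  show ?case
  proof (intro bexI ballI)
    show "p \<oplus>\<^bsub>poly_ring R\<^esub> q \<in> carrier (poly_ring R)" using p by simp
    fix t assume t: "t \<in> carrier R"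
    have "(\<lambda>i. a i \<oplus> t \<otimes> d i) \<in> I \<rightarrow> carrier R" using a d t by auto
    then show "eval (p \<oplus>\<^bsub>poly_ring R\<^esub> q) t
        = indexed_poly_eval R (indexed_padd P Q) (\<lambda>i. a i \<oplus> t \<otimes> d i)"
      using p t indexed_padd
      by (simp add: indexed_poly_eval_padd ring_hom_add[OF eval_is_hom[OF carrier_is_subring t]])
  qed
next
  case (indexed_pmult P i)
  interpret UP: domain "poly_ring R" by (rule univ_poly_is_domain[OF carrier_is_subring])
  from indexed_pmult obtain p where p: "p \<in> carrier (poly_ring R)"
    "\<forall>t\<in>carrier R. eval p t = indexed_poly_eval R P (\<lambda>i. a i \<oplus> t \<otimes> d i)" by auto
  have ai: "a i \<in> carrier R" "d i \<in> carrier R" using a d indexed_pmult by auto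
  \<comment> \<open>univariate polynomials are coefficient lists without leading zeros, highest degree first\<close>
  let ?l = "if d i = \<zero> then (if a i = \<zero> then [] else [a i]) else [d i, a i]"
  have l: "?l \<in> carrier (poly_ring R)" 
    using ai by (auto simp: univ_poly_carrier[symmetric] polynomial_def)
  show ?case
  proof (intro bexI ballI)
    show "?l \<otimes>\<^bsub>poly_ring R\<^esub> p \<in> carrier (poly_ring R)" using p l by blast
    fix t assume t: "t \<in> carrier R"
    have "(\<lambda>i. a i \<oplus> t \<otimes> d i) \<in> I \<rightarrow> carrier R" using a d t by auto
    moreover have "eval ?l t = a i \<oplus> t \<otimes> d i" using ai t by (auto simp: m_comm a_comm)
    ultimately show "eval (?l \<otimes>\<^bsub>poly_ring R\<^esub> p) t
        = indexed_poly_eval R (indexed_pmult P i) (\<lambda>i. a i \<oplus> t \<otimes> d i)"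
      using p t indexed_pmult
      by (simp only: indexed_poly_eval_pmult ring_hom_mult[OF eval_is_hom[OF carrier_is_subring t] l])
  qed
qed

text \<open>
  On the line through \<open>a\<close> and \<open>b\<close> neither polynomial vanishes identically, so both restrictions have
  finitely many roots, and some point of the line avoids them all.
\<close>
lemma indexed_poly_common_nonzero:
  assumes inf: "infinite (carrier R)"
    and P: "P \<in> indexed_pset I (carrier R)" and Q: "Q \<in> indexed_pset I (carrier R)"
    and a: "a \<in> I \<rightarrow> carrier R" "indexed_poly_eval R P a \<noteq> \<zero>"
    and b: "b \<in> I \<rightarrow> carrier R" "indexed_poly_eval R Q b \<noteq> \<zero>"
  shows "\<exists>c \<in> I \<rightarrow>\<^sub>E carrier R. indexed_poly_eval R P c \<noteq> \<zero> \<and> indexed_poly_eval R Q c \<noteq> \<zero>"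
proof -
  let ?d = "\<lambda>i. b i \<ominus> a i" and ?c = "\<lambda>t i. a i \<oplus> t \<otimes> (b i \<ominus> a i)"
  have d: "?d \<in> I \<rightarrow> carrier R" using a b by auto
  obtain p where p: "p \<in> carrier (poly_ring R)"
    "\<And>t. t \<in> carrier R \<Longrightarrow> eval p t = indexed_poly_eval R P (?c t)"
    using indexed_poly_on_line[OF P a(1) d] by auto
  obtain q where q: "q \<in> carrier (poly_ring R)"
    "\<And>t. t \<in> carrier R \<Longrightarrow> eval q t = indexed_poly_eval R Q (?c t)"
    using indexed_poly_on_line[OF Q a(1) d] by auto
  have c: "?c t \<in> I \<rightarrow> carrier R" if "t \<in> carrier R" for t
    using that a b by (auto simp: Pi_iff)
  have "indexed_poly_eval R P (?c \<zero>) = indexed_poly_eval R P a"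
    by (rule indexed_poly_eval_cong[OF P c]) (use a b in \<open>auto simp: Pi_iff\<close>)
  then have "p \<noteq> []" using p(2)[of \<zero>] a by auto
  have e: "x \<oplus> (y \<ominus> x) = y" if "x \<in> carrier R" "y \<in> carrier R" for x y
    using that by (metis a_minus_def a_comm a_assoc a_inv_closed l_neg r_zero)
  have "indexed_poly_eval R Q (?c \<one>) = indexed_poly_eval R Q b"
    by (rule indexed_poly_eval_cong[OF Q c]) (use a b e in \<open>auto simp: Pi_iff\<close>)
  then have "q \<noteq> []" using q(2)[of \<one>] b by auto
  have "finite ({t. is_root p t} \<union> {t. is_root q t})"
    using finite_number_of_roots p q by auto
  with inf obtain t where t: "t \<in> carrier R" "\<not> is_root p t" "\<not> is_root q t"
    by (metis (mono_tags, lifting) UnCI finite_subset mem_Collect_eq subsetI)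
  then have nz: "indexed_poly_eval R P (?c t) \<noteq> \<zero>" "indexed_poly_eval R Q (?c t) \<noteq> \<zero>"
    using p(2)[OF t(1)] q(2)[OF t(1)] \<open>p \<noteq> []\<close> \<open>q \<noteq> []\<close> by (auto simp: is_root_def)
  let ?e = "restrict (?c t) I"
  have "indexed_poly_eval R P (?c t) = indexed_poly_eval R P ?e"
    by (rule indexed_poly_eval_cong[OF P c[OF t(1)]]) simp
  moreover have "indexed_poly_eval R Q (?c t) = indexed_poly_eval R Q ?e"
    by (rule indexed_poly_eval_cong[OF Q c[OF t(1)]]) simp
  moreover have "?e \<in> I \<rightarrow>\<^sub>E carrier R"
    using c[OF t(1)] by auto
  ultimately show ?thesis using nz by metis
qed

end

section \<open>Residue modules\<close>

context module
begin

text \<open>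
  Two notions of submodule are in play, with different primitive closure conditions and with their
  arguments in different order; spans are developed for one of them, coverings are stated with the
  other.
\<close>
lemma linear_combinations_submodule_iff:
  "LinearCombinations.submodule R N M \<longleftrightarrow> Module.submodule N R M"
proof
  assume N: "LinearCombinations.submodule R N M"
  interpret N: LinearCombinations.submodule R N M by (rule N)
  have "\<ominus>\<^bsub>M\<^esub> x \<in> N" if "x \<in> N" for x
  proof -
    have "(\<ominus> \<one>) \<odot>\<^bsub>M\<^esub> x \<in> N" using that by (intro N.smult_closed) auto
    moreover have "x \<in> carrier M" using that N.subset by auto
    ultimately show ?thesis by (simp only: smult_minus_1)
  qed
  then show "Module.submodule N R M"
    using N.subset by (intro submoduleI) auto
next
  assume N: "Module.submodule N R M"
  note s = submoduleE[OF N]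
  obtain x where x: "x \<in> N" using s(2) by auto
  then have "x \<oplus>\<^bsub>M\<^esub> (\<ominus>\<^bsub>M\<^esub> x) \<in> N" using s(3,5) by blast
  then have "\<zero>\<^bsub>M\<^esub> \<in> N" using x s(1) M.r_neg by (metis subsetD)
  then show "LinearCombinations.submodule R N M"
    by (intro LinearCombinations.submodule.intro) (use s module_axioms in auto)
qed

lemma submodule_zero: "Module.submodule N R M \<Longrightarrow> \<zero>\<^bsub>M\<^esub> \<in> N"
  unfolding linear_combinations_submodule_iff[symmetric] by (rule LinearCombinations.submodule.zero_closed)

lemma span_least:
  assumes "Module.submodule N R M" "S \<subseteq> N"
  shows "span S \<subseteq> N"
  using assms span_is_subset[OF assms(2)] unfolding linear_combinations_submodule_iff by blast

lemma submodule_minus: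
  assumes "Module.submodule N R M" "x \<in> N" "y \<in> N"
  shows "x \<ominus>\<^bsub>M\<^esub> y \<in> N"
  using submoduleE[OF assms(1)] assms(2,3) by (simp add: a_minus_def)

lemma submodule_minus_cancel:
  assumes "Module.submodule N R M" "x \<ominus>\<^bsub>M\<^esub> y \<in> N" "x \<in> carrier M" "y \<in> carrier M"
  shows "x \<in> N \<longleftrightarrow> y \<in> N"
proof -
  have x: "(x \<ominus>\<^bsub>M\<^esub> y) \<oplus>\<^bsub>M\<^esub> y = x"
    using assms(3,4) by (simp add: a_minus_def M.a_assoc M.l_neg)
  then have y: "x \<ominus>\<^bsub>M\<^esub> (x \<ominus>\<^bsub>M\<^esub> y) = y"
    using assms(3,4) by (metis M.add.inv_solve_right M.minus_closed M.a_comm a_minus_def)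
  show ?thesis
  proof
    assume "x \<in> N"
    from submodule_minus[OF assms(1) this assms(2)] show "y \<in> N" unfolding y .
  next
    assume "y \<in> N"
    from submoduleE(5)[OF assms(1,2) this] show "x \<in> N" unfolding x .
  qed
qed

lemma abelian_subgroup_of_submodule:
  "Module.submodule N R M \<Longrightarrow> abelian_subgroup N M"
  by (intro abelian_subgroupI3 additive_subgroup.intro)
     (auto simp: Module.submodule_def M.abelian_group_axioms)

lemma submodule_coset_mem_iff:
  assumes N: "Module.submodule N R M" and x: "x \<in> carrier M"
  shows "y \<in> N +>\<^bsub>M\<^esub> x \<longleftrightarrow> y \<in> carrier M \<and> y \<ominus>\<^bsub>M\<^esub> x \<in> N"
proof -
  interpret N: abelian_subgroup N M by (rule abelian_subgroup_of_submodule[OF N])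
  have "N +>\<^bsub>M\<^esub> x \<subseteq> carrier M" using x by (simp add: N.a_subset M.a_r_coset_subset_G)
  moreover have "y \<in> N +>\<^bsub>M\<^esub> x \<longleftrightarrow> y \<ominus>\<^bsub>M\<^esub> x \<in> N" if "y \<in> carrier M"
    using N.a_rcos_module[OF x that] by (simp add: a_minus_def)
  ultimately show ?thesis by blast
qed

lemma submodule_coset_eq_iff:
  assumes N: "Module.submodule N R M" and x: "x \<in> carrier M" and y: "y \<in> carrier M"
  shows "N +>\<^bsub>M\<^esub> x = N +>\<^bsub>M\<^esub> y \<longleftrightarrow> x \<ominus>\<^bsub>M\<^esub> y \<in> N"
proof -
  interpret N: abelian_subgroup N M by (rule abelian_subgroup_of_submodule[OF N])
  have "N +>\<^bsub>M\<^esub> x = N +>\<^bsub>M\<^esub> y \<longleftrightarrow> x \<in> N +>\<^bsub>M\<^esub> y"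
    using N.a_rcos_self[OF x] M.a_repr_independence[OF _ y N.a_subgroup] by blast
  then show ?thesis using submodule_coset_mem_iff[OF N y] x by blast
qed

lemma ideal_smult_submodule:
  assumes "ideal I R" shows "Module.submodule (ideal_smult R M I) R M"
proof -
  have "I \<subseteq> carrier R" by (rule additive_subgroup.a_subset[OF ideal.axioms(1)[OF assms(1)]])
  then have "{a \<odot>\<^bsub>M\<^esub> x | a x. a \<in> I \<and> x \<in> carrier M} \<subseteq> carrier M" by auto
  from span_is_submodule[OF this] show ?thesis
    unfolding ideal_smult_def linear_combinations_submodule_iff .
qed

lemma smult_in_ideal_smult:
  assumes "ideal I R" "a \<in> I" "x \<in> carrier M"
  shows "a \<odot>\<^bsub>M\<^esub> x \<in> ideal_smult R M I"
proof -
  have "I \<subseteq> carrier R" by (rule additive_subgroup.a_subset[OF ideal.axioms(1)[OF assms(1)]])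
  then have "{a \<odot>\<^bsub>M\<^esub> x | a x. a \<in> I \<and> x \<in> carrier M} \<subseteq> carrier M" by auto
  from in_own_span[OF this] show ?thesis
    unfolding ideal_smult_def using assms by blast
qed

lemma ideal_smult_least:
  assumes "Module.submodule N R M" "\<And>a x. a \<in> I \<Longrightarrow> x \<in> carrier M \<Longrightarrow> a \<odot>\<^bsub>M\<^esub> x \<in> N"
  shows "ideal_smult R M I \<subseteq> N"
  unfolding ideal_smult_def using assms by (intro span_least) auto

abbreviation residue_class :: "'a set \<Rightarrow> 'c \<Rightarrow> 'c set" where
  "residue_class I x \<equiv> ideal_smult R M I +>\<^bsub>M\<^esub> x"

lemma residue_class_eq_iff:
  assumes "ideal I R" "x \<in> carrier M" "y \<in> carrier M"
  shows "residue_class I x = residue_class I y \<longleftrightarrow> x \<ominus>\<^bsub>M\<^esub> y \<in> ideal_smult R M I"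
  using submodule_coset_eq_iff[OF ideal_smult_submodule] assms by blast

lemma carrier_residue_module:
  "carrier (residue_module R M I) = residue_class I ` carrier M"
  by (auto simp: residue_module_def Let_def A_RCOSETS_def')

lemma residue_class_closed:
  "x \<in> carrier M \<Longrightarrow> residue_class I x \<in> carrier (residue_module R M I)"
  by (simp add: carrier_residue_module)

lemma zero_residue_module:
  assumes "ideal I R"
  shows "\<zero>\<^bsub>residue_module R M I\<^esub> = residue_class I \<zero>\<^bsub>M\<^esub>"
proof -
  interpret N: abelian_subgroup "ideal_smult R M I" M
    by (rule abelian_subgroup_of_submodule[OF ideal_smult_submodule[OF assms]])
  show ?thesis by (simp add: residue_module_def Let_def N.a_subset M.a_coset_add_zero)
qed

lemma add_residue_module:
  assumes "ideal I R" "x \<in> carrier M" "y \<in> carrier M"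
  shows "residue_class I x \<oplus>\<^bsub>residue_module R M I\<^esub> residue_class I y = residue_class I (x \<oplus>\<^bsub>M\<^esub> y)"
proof -
  interpret N: abelian_subgroup "ideal_smult R M I" M
    by (rule abelian_subgroup_of_submodule[OF ideal_smult_submodule[OF assms(1)]])
  show ?thesis using assms by (simp add: residue_module_def Let_def N.a_rcos_sum)
qed

lemma smult_residue_module:
  assumes I: "ideal I R" and r: "r \<in> carrier R" and y: "y \<in> carrier M"
  shows "(I +> r) \<odot>\<^bsub>residue_module R M I\<^esub> residue_class I y = residue_class I (r \<odot>\<^bsub>M\<^esub> y)"
proof -
  note N = ideal_smult_submodule[OF I]
  interpret I: ideal I R by (rule I)
  interpret N: abelian_subgroup "ideal_smult R M I" M
    by (rule abelian_subgroup_of_submodule[OF N])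
  have c: "residue_class I (a \<odot>\<^bsub>M\<^esub> x) = residue_class I (r \<odot>\<^bsub>M\<^esub> y)"
    if a: "a \<in> I +> r" and x: "x \<in> residue_class I y" for a x
  proof -
    obtain i where i: "i \<in> I" "a = i \<oplus> r" using a by (auto simp: a_r_coset_def')
    obtain n where n: "n \<in> ideal_smult R M I" "x = n \<oplus>\<^bsub>M\<^esub> y" using x by (auto simp: a_r_coset_def')
    have iR: "i \<in> carrier R" and nM: "n \<in> carrier M" using i n I.Icarr N.a_subset by auto
    have "a \<odot>\<^bsub>M\<^esub> x = (i \<odot>\<^bsub>M\<^esub> x \<oplus>\<^bsub>M\<^esub> r \<odot>\<^bsub>M\<^esub> n) \<oplus>\<^bsub>M\<^esub> r \<odot>\<^bsub>M\<^esub> y"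
      using i n iR nM r y by (simp add: smult_l_distr smult_r_distr M.a_ac)
    then have "a \<odot>\<^bsub>M\<^esub> x \<ominus>\<^bsub>M\<^esub> r \<odot>\<^bsub>M\<^esub> y = i \<odot>\<^bsub>M\<^esub> x \<oplus>\<^bsub>M\<^esub> r \<odot>\<^bsub>M\<^esub> n"
      using i n iR nM r y by (simp add: a_minus_def M.a_assoc M.r_neg)
    moreover have "i \<odot>\<^bsub>M\<^esub> x \<oplus>\<^bsub>M\<^esub> r \<odot>\<^bsub>M\<^esub> n \<in> ideal_smult R M I"
      using submoduleE(4,5)[OF N] smult_in_ideal_smult[OF I] i n nM r y by auto
    ultimately show ?thesis
      using i n iR nM r y residue_class_eq_iff[OF I] by simp
  qed
  have "r \<in> I +> r" "y \<in> residue_class I y"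
    using r y N.a_rcos_self I.a_rcos_self by auto
  then have "(\<Union>a\<in>I +> r. \<Union>x\<in>residue_class I y. residue_class I (a \<odot>\<^bsub>M\<^esub> x)) = residue_class I (r \<odot>\<^bsub>M\<^esub> y)"
    using c by blast
  then show ?thesis by (simp add: residue_module_def Let_def)
qed

lemma carrier_Quot: "carrier (R Quot I) = (+>) I ` carrier R"
  by (auto simp: FactRing_def A_RCOSETS_def')

lemma residue_module_is_module:
  assumes I: "ideal I R"
  shows "module (R Quot I) (residue_module R M I)"
proof -
  interpret I: ideal I R by (rule I)
  interpret N: abelian_subgroup "ideal_smult R M I" M
    by (rule abelian_subgroup_of_submodule[OF ideal_smult_submodule[OF I]])
  let ?V = "residue_module R M I"
  interpret h: ring_hom_ring R "R Quot I" "(+>) I" by (rule I.rcos_ring_hom_ring)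
  have ab: "abelian_group ?V"
  proof (rule abelian_groupI)
    fix x assume "x \<in> carrier ?V"
    then obtain u where u: "u \<in> carrier M" "x = residue_class I u"
      by (auto simp: carrier_residue_module)
    then show "\<exists>y\<in>carrier ?V. y \<oplus>\<^bsub>?V\<^esub> x = \<zero>\<^bsub>?V\<^esub>"
      by (intro bexI[of _ "residue_class I (\<ominus>\<^bsub>M\<^esub> u)"])
         (simp_all add: add_residue_module[OF I] zero_residue_module[OF I] M.l_neg residue_class_closed)
  qed (auto simp: carrier_residue_module add_residue_module[OF I] zero_residue_module[OF I] M.a_ac)
  show ?thesis
  proof (rule moduleI)
    show "cring (R Quot I)" by (rule I.quotient_is_cring[OF R.is_cring])
    show "abelian_group ?V" by (rule ab)
  next
    fix a x assume "a \<in> carrier (R Quot I)" "x \<in> carrier ?V"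
    then show "a \<odot>\<^bsub>?V\<^esub> x \<in> carrier ?V"
      by (auto simp: carrier_Quot carrier_residue_module smult_residue_module[OF I])
  next
    fix a b x assume "a \<in> carrier (R Quot I)" "b \<in> carrier (R Quot I)" "x \<in> carrier ?V"
    then obtain r s y where *: "r \<in> carrier R" "s \<in> carrier R" "y \<in> carrier M"
      "a = I +> r" "b = I +> s" "x = residue_class I y"
      by (auto simp: carrier_Quot carrier_residue_module)
    have "a \<oplus>\<^bsub>R Quot I\<^esub> b = I +> (r \<oplus> s)" "a \<otimes>\<^bsub>R Quot I\<^esub> b = I +> (r \<otimes> s)"
      using * by simp_all
    then show "(a \<oplus>\<^bsub>R Quot I\<^esub> b) \<odot>\<^bsub>?V\<^esub> x = a \<odot>\<^bsub>?V\<^esub> x \<oplus>\<^bsub>?V\<^esub> b \<odot>\<^bsub>?V\<^esub> x"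
      "(a \<otimes>\<^bsub>R Quot I\<^esub> b) \<odot>\<^bsub>?V\<^esub> x = a \<odot>\<^bsub>?V\<^esub> (b \<odot>\<^bsub>?V\<^esub> x)"
      using * by (simp_all only: smult_residue_module[OF I] add_residue_module[OF I]
          smult_l_distr smult_assoc1 smult_closed R.a_closed R.m_closed)
  next
    fix a x y assume "a \<in> carrier (R Quot I)" "x \<in> carrier ?V" "y \<in> carrier ?V"
    then obtain r u v where "r \<in> carrier R" "u \<in> carrier M" "v \<in> carrier M"
      "a = I +> r" "x = residue_class I u" "y = residue_class I v"
      by (auto simp: carrier_Quot carrier_residue_module)
    then show "a \<odot>\<^bsub>?V\<^esub> (x \<oplus>\<^bsub>?V\<^esub> y) = a \<odot>\<^bsub>?V\<^esub> x \<oplus>\<^bsub>?V\<^esub> a \<odot>\<^bsub>?V\<^esub> y"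
      by (simp only: smult_residue_module[OF I] add_residue_module[OF I]
          smult_r_distr smult_closed M.a_closed)
  next
    fix x assume "x \<in> carrier ?V"
    then obtain u where *: "u \<in> carrier M" "x = residue_class I u"
      by (auto simp: carrier_residue_module)
    have "\<one>\<^bsub>R Quot I\<^esub> = I +> \<one>" by simp
    then show "\<one>\<^bsub>R Quot I\<^esub> \<odot>\<^bsub>?V\<^esub> x = x"
      using * by (simp only: smult_residue_module[OF I] smult_one R.one_closed)
  qed
qed

lemma residue_module_is_vectorspace:
  assumes "maximalideal I R"
  shows "vectorspace (R Quot I) (residue_module R M I)"
  using assms residue_module_is_module maximalideal.axioms(1) maximalideal.quotient_is_field R.is_cring
  by (auto simp: vectorspace_def)

text \<open>
  Reduction is additive, and multiplication by \<open>r\<close> on \<open>M\<close> reduces to multiplication by the class of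
  \<open>r\<close>. Hence preimages of submodules over the residue ring are submodules over \<open>R\<close>.
\<close>
lemma submodule_of_residue_module:
  assumes I: "ideal I R" and W: "Module.submodule W (R Quot I) (residue_module R M I)"
  shows "Module.submodule {x \<in> carrier M. residue_class I x \<in> W} R M"
proof -
  interpret V: module "R Quot I" "residue_module R M I" by (rule residue_module_is_module[OF I])
  note w = V.submoduleE[OF W]
  have s: "residue_class I (r \<odot>\<^bsub>M\<^esub> x) \<in> W" if "r \<in> carrier R" "x \<in> carrier M" "residue_class I x \<in> W" for r x
    using w(4)[of "I +> r" "residue_class I x"] that by (auto simp: smult_residue_module[OF I] carrier_Quot)
  show ?thesis
  proof (rule submoduleI)
    show "\<zero>\<^bsub>M\<^esub> \<in> {x \<in> carrier M. residue_class I x \<in> W}"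
      using V.submodule_zero[OF W] by (simp add: zero_residue_module[OF I])
    show "\<ominus>\<^bsub>M\<^esub> x \<in> {x \<in> carrier M. residue_class I x \<in> W}"
      if "x \<in> {x \<in> carrier M. residue_class I x \<in> W}" for x
      using s[of "\<ominus> \<one>" x] that by (simp add: smult_minus_1)
    show "x \<oplus>\<^bsub>M\<^esub> y \<in> {x \<in> carrier M. residue_class I x \<in> W}"
      if "x \<in> {x \<in> carrier M. residue_class I x \<in> W}" "y \<in> {x \<in> carrier M. residue_class I x \<in> W}" for x y
      using w(5)[of "residue_class I x" "residue_class I y"] that by (simp add: add_residue_module[OF I])
  qed (use s in auto)
qed

text \<open>
  The classes of a finite generating set generate: the preimage of their span is a submodule of
  \<open>M\<close> that contains the generating set, hence all of \<open>M\<close>.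
\<close>
lemma residue_module_fin_dim:
  assumes fg: "fin_gen_module R M" and I: "maximalideal I R"
  shows "vectorspace.fin_dim (R Quot I) (residue_module R M I)"
proof -
  let ?V = "residue_module R M I"
  have id: "ideal I R" using I by (rule maximalideal.axioms(1))
  interpret V: vectorspace "R Quot I" ?V by (rule residue_module_is_vectorspace[OF I])
  obtain A where A: "finite A" "A \<subseteq> carrier M" "span A = carrier M"
    using fg by (auto simp: fin_gen_module_def)
  let ?B = "residue_class I ` A"
  have B: "finite ?B" "?B \<subseteq> carrier ?V" using A by (auto simp: carrier_residue_module)
  have "Module.submodule (V.span ?B) (R Quot I) ?V"
    using V.span_is_submodule[OF B(2)] unfolding V.linear_combinations_submodule_iff .
  then have "Module.submodule {x \<in> carrier M. residue_class I x \<in> V.span ?B} R M"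
    by (rule submodule_of_residue_module[OF id])
  moreover have "A \<subseteq> {x \<in> carrier M. residue_class I x \<in> V.span ?B}"
    using A V.in_own_span[OF B(2)] by auto
  ultimately have "carrier M \<subseteq> {x \<in> carrier M. residue_class I x \<in> V.span ?B}"
    using span_least A(3) by blast
  then have "V.span ?B = carrier ?V"
    using V.span_is_subset2[OF B(2)] by (auto simp: carrier_residue_module)
  then show ?thesis using B by (auto simp: V.fin_dim_def)
qed

end

section \<open>The Chinese remainder theorem and maximal submodules\<close>

lemma (in abelian_group) add_minus_cancel:
  assumes "x \<in> carrier G" "y \<in> carrier G"
  shows "(x \<oplus> y) \<ominus> x = y"
  using assms by (simp add: a_minus_def a_comm[of x] a_assoc r_neg)

text \<open>
  Distinct maximal ideals are comaximal. Multiplying, over \<open>\<nn> \<in> F\<close>, elements of \<open>\<nn>\<close> that are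
  congruent to one modulo \<open>\<mm>\<close> gives the required idempotent-like element.
\<close>
lemma (in cring) maximal_ideal_separation:
  assumes "finite F" "\<mm> \<in> mSpec R" "F \<subseteq> mSpec R" "\<mm> \<notin> F"
  shows "\<exists>e\<in>carrier R. \<one> \<ominus> e \<in> \<mm> \<and> (\<forall>\<nn>\<in>F. e \<in> \<nn>)"
  using assms
proof (induction F)
  case empty
  then interpret m: ideal \<mm> R by (auto simp: mSpec_def maximalideal_def)
  show ?case using m.zero_closed by (intro bexI[of _ \<one>]) (auto simp: a_minus_def r_neg)
next
  case (insert \<nn> F)
  then obtain e where e: "e \<in> carrier R" "\<one> \<ominus> e \<in> \<mm>" "\<forall>\<nn>\<in>F. e \<in> \<nn>" by auto
  interpret m: maximalideal \<mm> R using insert by (auto simp: mSpec_def)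
  interpret n: maximalideal \<nn> R using insert by (auto simp: mSpec_def)
  have "\<mm> \<noteq> \<nn>" using insert by auto
  have mI: "ideal \<mm> R" and nI: "ideal \<nn> R" by unfold_locales
  have sub: "\<mm> \<subseteq> carrier R" "\<nn> \<subseteq> carrier R" using m.Icarr n.Icarr by auto
  have J: "ideal (\<mm> <+>\<^bsub>R\<^esub> \<nn>) R" by (rule add_ideals[OF mI nI])
  have Jm: "\<mm> \<subseteq> \<mm> <+>\<^bsub>R\<^esub> \<nn>" and Jn: "\<nn> \<subseteq> \<mm> <+>\<^bsub>R\<^esub> \<nn>"
    using sub m.zero_closed n.zero_closed
    by (force simp: set_add_def' intro: r_zero[symmetric] l_zero[symmetric])+
  have "\<mm> <+>\<^bsub>R\<^esub> \<nn> = carrier R"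
  proof (rule ccontr)
    assume ne: "\<mm> <+>\<^bsub>R\<^esub> \<nn> \<noteq> carrier R"
    have c: "\<mm> <+>\<^bsub>R\<^esub> \<nn> \<subseteq> carrier R" using ideal.Icarr[OF J] by auto
    have "\<mm> <+>\<^bsub>R\<^esub> \<nn> = \<mm>" "\<mm> <+>\<^bsub>R\<^esub> \<nn> = \<nn>"
      using m.I_maximal[OF J Jm c] n.I_maximal[OF J Jn c] ne by auto
    with \<open>\<mm> \<noteq> \<nn>\<close> show False by simp
  qed
  then have "\<one> \<in> \<mm> <+>\<^bsub>R\<^esub> \<nn>" by simp
  then obtain a f where af: "a \<in> \<mm>" "f \<in> \<nn>" "\<one> = a \<oplus> f" by (auto simp: set_add_def')
  have aR: "a \<in> carrier R" "f \<in> carrier R" using af sub by auto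
  show ?case
  proof (intro bexI conjI ballI)
    show ef: "e \<otimes> f \<in> carrier R" using e aR by simp
    \<comment> \<open>both summands lie in \<open>\<mm>\<close>\<close>
    have "\<one> \<ominus> e \<otimes> f = (\<one> \<ominus> e) \<oplus> e \<otimes> (\<one> \<ominus> f)"
      using e aR by algebra
    moreover have "\<one> \<ominus> f = a" unfolding af(3) using aR by algebra
    ultimately show "\<one> \<ominus> e \<otimes> f \<in> \<mm>"
      using e af m.a_closed m.I_l_closed by simp
    fix \<pp> assume p: "\<pp> \<in> insert \<nn> F"
    then interpret p: ideal \<pp> R using insert by (auto simp: mSpec_def maximalideal_def)
    show "e \<otimes> f \<in> \<pp>"
    proof (cases "\<pp> = \<nn>")
      case True
      then show ?thesis using n.I_l_closed[OF af(2) e(1)] by simp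
    next
      case False
      then show ?thesis using p e p.I_r_closed[OF _ aR(2)] by auto
    qed
  qed
qed

context module
begin

text \<open>
  The Chinese remainder theorem for modules. Correcting \<open>y\<close> by \<open>e (x \<mm> - y)\<close>, where \<open>e\<close> is one modulo
  \<open>\<mm>\<close> and zero modulo the ideals treated before, adjusts the class modulo \<open>\<mm>\<close> and preserves the others.
\<close>
lemma residue_classes_simultaneous:
  assumes "finite F" "F \<subseteq> mSpec R" "\<And>\<mm>. \<mm> \<in> F \<Longrightarrow> x \<mm> \<in> carrier M"
  shows "\<exists>y\<in>carrier M. \<forall>\<mm>\<in>F. residue_class \<mm> y = residue_class \<mm> (x \<mm>)"
  using assms
proof (induction F)
  case empty
  show ?case by auto
next
  case (insert \<mm> F)
  then obtain y where y: "y \<in> carrier M" "\<forall>\<nn>\<in>F. residue_class \<nn> y = residue_class \<nn> (x \<nn>)" by auto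
  obtain e where e: "e \<in> carrier R" "\<one> \<ominus> e \<in> \<mm>" "\<forall>\<nn>\<in>F. e \<in> \<nn>"
    using R.maximal_ideal_separation[of F \<mm>] insert by auto
  have xm: "x \<mm> \<in> carrier M" using insert by auto
  have idl: "ideal \<nn> R" if "\<nn> \<in> insert \<mm> F" for \<nn>
    using insert that by (auto simp: mSpec_def maximalideal_def)
  let ?d = "x \<mm> \<ominus>\<^bsub>M\<^esub> y" and ?z = "y \<oplus>\<^bsub>M\<^esub> e \<odot>\<^bsub>M\<^esub> (x \<mm> \<ominus>\<^bsub>M\<^esub> y)"
  have d: "?d \<in> carrier M" "e \<odot>\<^bsub>M\<^esub> ?d \<in> carrier M" using xm y e by auto
  show ?case
  proof (intro bexI ballI)
    show z: "?z \<in> carrier M" using y d by simp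
    fix \<nn> assume n: "\<nn> \<in> insert \<mm> F"
    show "residue_class \<nn> ?z = residue_class \<nn> (x \<nn>)"
    proof (cases "\<nn> = \<mm>")
      case True
      have "(\<one> \<ominus> e) \<odot>\<^bsub>M\<^esub> ?d = ?d \<ominus>\<^bsub>M\<^esub> e \<odot>\<^bsub>M\<^esub> ?d"
        using e d by (simp add: a_minus_def smult_l_distr smult_l_minus)
      then have "x \<mm> = (\<one> \<ominus> e) \<odot>\<^bsub>M\<^esub> ?d \<oplus>\<^bsub>M\<^esub> ?z"
        using d xm y by (simp add: a_minus_def M.a_ac M.r_neg1 M.r_neg2 M.l_neg M.r_neg)
      then have "x \<mm> \<ominus>\<^bsub>M\<^esub> ?z = (\<one> \<ominus> e) \<odot>\<^bsub>M\<^esub> ?d"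
        using z d e by (metis M.add.inv_solve_right R.minus_closed R.one_closed a_minus_def smult_closed xm)
      then have "x \<mm> \<ominus>\<^bsub>M\<^esub> ?z \<in> ideal_smult R M \<mm>"
        using smult_in_ideal_smult[OF idl e(2) d(1)] by simp
      then show ?thesis using residue_class_eq_iff[OF idl[OF n] xm z] True by simp
    next
      case False
      then have "e \<odot>\<^bsub>M\<^esub> ?d \<in> ideal_smult R M \<nn>"
        using smult_in_ideal_smult[OF idl[OF n] _ d(1)] e n by auto
      moreover have "?z \<ominus>\<^bsub>M\<^esub> y = e \<odot>\<^bsub>M\<^esub> ?d"
        using y(1) d(2) by (rule M.add_minus_cancel)
      ultimately have "residue_class \<nn> ?z = residue_class \<nn> y"
        using residue_class_eq_iff[OF idl[OF n] z y(1)] by simp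
      then show ?thesis using y n False by simp
    qed
  qed
qed

text \<open>
  Zorn's lemma. The union of a chain of proper submodules is proper, for otherwise a single member
  would contain the finite generating set.
\<close>
lemma exists_maximal_submodule:
  assumes fg: "fin_gen_module R M" and N: "Module.submodule N R M" "N \<noteq> carrier M"
  shows "\<exists>L. Module.submodule L R M \<and> N \<subseteq> L \<and> L \<noteq> carrier M \<and>
    (\<forall>L'. Module.submodule L' R M \<and> L \<subseteq> L' \<and> L' \<noteq> carrier M \<longrightarrow> L' = L)"
proof -
  obtain A where A: "finite A" "A \<subseteq> carrier M" "span A = carrier M"
    using fg by (auto simp: fin_gen_module_def)
  let ?S = "{L. Module.submodule L R M \<and> N \<subseteq> L \<and> L \<noteq> carrier M}"
  have "\<exists>L\<in>?S. \<forall>L'\<in>?S. L \<subseteq> L' \<longrightarrow> L' = L"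
  proof (rule subset_Zorn_nonempty)
    show "?S \<noteq> {}" using N by auto
    fix \<C> assume ne: "\<C> \<noteq> {}" and ch: "subset.chain ?S \<C>"
    then have C: "\<And>L. L \<in> \<C> \<Longrightarrow> Module.submodule L R M \<and> N \<subseteq> L \<and> L \<noteq> carrier M"
      by (auto simp: subset.chain_def)
    have sub: "\<And>L. L \<in> \<C> \<Longrightarrow> Module.submodule L R M" using C by blast
    have U: "Module.submodule (\<Union>\<C>) R M"
    proof (rule submoduleI)
      show "\<Union>\<C> \<subseteq> carrier M" using submoduleE(1)[OF sub] by blast
      show "\<zero>\<^bsub>M\<^esub> \<in> \<Union>\<C>" using ne submodule_zero[OF sub] by blast
      show "\<ominus>\<^bsub>M\<^esub> a \<in> \<Union>\<C>" if "a \<in> \<Union>\<C>" for a using that submoduleE(3)[OF sub] by blast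
      show "r \<odot>\<^bsub>M\<^esub> a \<in> \<Union>\<C>" if "r \<in> carrier R" "a \<in> \<Union>\<C>" for r a
        using that submoduleE(4)[OF sub] by blast
      show "a \<oplus>\<^bsub>M\<^esub> b \<in> \<Union>\<C>" if a: "a \<in> \<Union>\<C>" and b: "b \<in> \<Union>\<C>" for a b
      proof -
        obtain B where "B \<in> \<C>" "{a, b} \<subseteq> B"
          using finite_subset_Union_chain[OF _ _ ne ch, of "{a, b}"] a b by auto
        then show ?thesis using submoduleE(5)[OF sub] by blast
      qed
    qed
    have "\<Union>\<C> \<noteq> carrier M"
    proof
      assume "\<Union>\<C> = carrier M"
      then obtain B where B: "B \<in> \<C>" "A \<subseteq> B"
        using finite_subset_Union_chain[OF A(1) _ ne ch] A(2) by auto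
      then have "carrier M \<subseteq> B" using span_least[OF sub[OF B(1)] B(2)] A(3) by simp
      then show False using C[OF B(1)] submoduleE(1)[OF sub[OF B(1)]] by blast
    qed
    moreover have "N \<subseteq> \<Union>\<C>" using ne C by blast
    ultimately show "\<Union>\<C> \<in> ?S" using U by blast
  qed
  then obtain L where L: "L \<in> ?S" "\<forall>L'\<in>?S. L \<subseteq> L' \<longrightarrow> L' = L" by (elim bexE)
  have "L' = L" if "Module.submodule L' R M" "L \<subseteq> L'" "L' \<noteq> carrier M" for L'
    by (rule L(2)[rule_format]) (use that L(1) in auto)
  then show ?thesis using L(1) by (intro exI[of _ L]) simp
qed

end

section \<open>The Zariski topology of a vector space\<close>

lemma (in module) linear_functional_lincomb:
  assumes B: "finite B" "B \<subseteq> carrier M" "c \<in> B \<rightarrow> carrier R"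
    and l: "l \<in> carrier M \<rightarrow> carrier R"
    and add: "\<And>x y. x \<in> carrier M \<Longrightarrow> y \<in> carrier M \<Longrightarrow> l (x \<oplus>\<^bsub>M\<^esub> y) = l x \<oplus> l y"
    and smult: "\<And>r x. r \<in> carrier R \<Longrightarrow> x \<in> carrier M \<Longrightarrow> l (r \<odot>\<^bsub>M\<^esub> x) = r \<otimes> l x"
  shows "l (lincomb c B) = (\<Oplus>b\<in>B. c b \<otimes> l b)"
  using B
proof (induction B)
  case empty
  have "l \<zero>\<^bsub>M\<^esub> = l (\<zero> \<odot>\<^bsub>M\<^esub> \<zero>\<^bsub>M\<^esub>)" by simp
  also have "\<dots> = \<zero> \<otimes> l \<zero>\<^bsub>M\<^esub>" by (rule smult) auto
  also have "\<dots> = \<zero>" using l by (intro R.l_null) auto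
  finally show ?case by (simp add: lincomb_def)
next
  case (insert b B)
  have c: "c \<in> B \<rightarrow> carrier R" "c b \<in> carrier R" "b \<in> carrier M" "B \<subseteq> carrier M" using insert by auto
  have "lincomb c (insert b B) = c b \<odot>\<^bsub>M\<^esub> b \<oplus>\<^bsub>M\<^esub> lincomb c B"
    using lincomb_insert[of B c b] insert by simp
  then have "l (lincomb c (insert b B)) = c b \<otimes> l b \<oplus> l (lincomb c B)"
    using c by (simp add: add smult)
  also have "\<dots> = c b \<otimes> l b \<oplus> (\<Oplus>b\<in>B. c b \<otimes> l b)" using insert c by simp
  also have "\<dots> = (\<Oplus>b\<in>insert b B. c b \<otimes> l b)"
    by (rule R.finsum_insert[symmetric]) (use insert c l in \<open>auto simp: Pi_iff subset_iff\<close>)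
  finally show ?case .
qed

context vectorspace
begin

text \<open>
  Coordinate functions are determined only on the basis, so the uniqueness of extensional coordinate
  functions is restated here pointwise.
\<close>
lemma basis_lincomb_inj:
  assumes B: "finite B" "basis B" and c: "c \<in> B \<rightarrow> carrier K" and d: "d \<in> B \<rightarrow> carrier K"
    and eq: "lincomb c B = lincomb d B" and b: "b \<in> B"
  shows "c b = d b"
proof -
  have BV: "B \<subseteq> carrier V" using B by (simp add: basis_def)
  have r: "lincomb (restrict e B) B = lincomb e B" if "e \<in> B \<rightarrow> carrier K" for e
    by (rule lincomb_cong) (use BV that in auto)
  have "restrict c B \<in> B \<rightarrow>\<^sub>E carrier K" "restrict d B \<in> B \<rightarrow>\<^sub>E carrier K" using c d by auto
  moreover have "lincomb (restrict c B) B = lincomb c B" "lincomb (restrict d B) B = lincomb c B"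
    using r c d eq by auto
  moreover have "lincomb c B \<in> carrier V" using BV c by simp
  ultimately have "restrict c B = restrict d B"
    using basis_criterion[OF B(1) BV] B(2) by blast
  then show ?thesis using b by (metis restrict_apply')
qed

lemma basis_lincomb_exists:
  assumes B: "finite B" "basis B" and v: "v \<in> carrier V"
  shows "\<exists>c \<in> B \<rightarrow>\<^sub>E carrier K. v = lincomb c B"
proof -
  have BV: "B \<subseteq> carrier V" using B by (simp add: basis_def)
  show ?thesis using basis_criterion[OF B(1) BV] B(2) v by blast
qed

lemma lincomb_in_zariski_zero_set_iff:
  assumes B: "finite B" "basis B" and F: "F \<subseteq> indexed_pset B (carrier K)"
    and c: "c \<in> B \<rightarrow> carrier K"
  shows "lincomb c B \<in> zariski_zero_set K V B F \<longleftrightarrow> (\<forall>P\<in>F. indexed_poly_eval K P c = \<zero>\<^bsub>K\<^esub>)"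
proof
  assume "lincomb c B \<in> zariski_zero_set K V B F"
  then obtain d where d: "d \<in> B \<rightarrow>\<^sub>E carrier K" "lincomb c B = lincomb d B"
    "\<forall>P\<in>F. indexed_poly_eval K P d = \<zero>\<^bsub>K\<^esub>" unfolding zariski_zero_set_def by blast
  have "c b = d b" if "b \<in> B" for b
    by (rule basis_lincomb_inj[OF B c _ d(2) that]) (use d in auto)
  then have "indexed_poly_eval K P c = indexed_poly_eval K P d" if "P \<in> F" for P
    using indexed_poly_eval_cong[OF _ c] F that by blast
  then show "\<forall>P\<in>F. indexed_poly_eval K P c = \<zero>\<^bsub>K\<^esub>" using d by simp
next
  assume z: "\<forall>P\<in>F. indexed_poly_eval K P c = \<zero>\<^bsub>K\<^esub>"
  have BV: "B \<subseteq> carrier V" using B by (simp add: basis_def)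
  have "lincomb (restrict c B) B = lincomb c B"
    by (rule lincomb_cong) (use BV c in auto)
  moreover have "restrict c B \<in> B \<rightarrow>\<^sub>E carrier K" using c by auto
  moreover have "indexed_poly_eval K P c = indexed_poly_eval K P (restrict c B)" if "P \<in> F" for P
    by (rule indexed_poly_eval_cong[OF _ c]) (use F that in auto)
  ultimately show "lincomb c B \<in> zariski_zero_set K V B F"
    unfolding zariski_zero_set_def using z by (intro CollectI exI[of _ "restrict c B"]) auto
qed

lemma zariski_zero_set_subset:
  assumes "basis B" shows "zariski_zero_set K V B F \<subseteq> carrier V"
proof -
  have BV: "B \<subseteq> carrier V" using assms by (simp add: basis_def)
  then show ?thesis unfolding zariski_zero_set_def by (auto simp: PiE_iff)
qed

lemma zariski_zero_set_eqI:
  assumes B: "finite B" "basis B" and F: "F \<subseteq> indexed_pset B (carrier K)"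
    and W: "W \<subseteq> carrier V"
    and eq: "\<And>c. c \<in> B \<rightarrow> carrier K \<Longrightarrow> lincomb c B \<in> W \<longleftrightarrow> (\<forall>P\<in>F. indexed_poly_eval K P c = \<zero>\<^bsub>K\<^esub>)"
  shows "zariski_zero_set K V B F = W"
proof -
  have "v \<in> zariski_zero_set K V B F \<longleftrightarrow> v \<in> W" if v: "v \<in> carrier V" for v
  proof -
    obtain c where c: "c \<in> B \<rightarrow>\<^sub>E carrier K" "v = lincomb c B"
      using basis_lincomb_exists[OF B v] by blast
    then have c': "c \<in> B \<rightarrow> carrier K" by auto
    show ?thesis unfolding c(2) lincomb_in_zariski_zero_set_iff[OF B F c'] eq[OF c'] ..
  qed
  then show ?thesis using W zariski_zero_set_subset[OF B(2)] by blast
qed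

text \<open>
  Intersections of zero sets are zero sets of unions, and unions of two are zero sets of families of
  products because a field has no zero divisors.
\<close>
lemma zariski_closed_sets:
  assumes B: "finite B" "basis B"
  defines "\<Z> \<equiv> {zariski_zero_set K V B F | F. F \<subseteq> indexed_pset B (carrier K)}"
  shows "{} \<in> \<Z>" "carrier V \<in> \<Z>" "\<And>A C. A \<in> \<Z> \<Longrightarrow> C \<in> \<Z> \<Longrightarrow> A \<union> C \<in> \<Z>"
    "\<And>\<K>. \<K> \<subseteq> \<Z> \<Longrightarrow> \<K> \<noteq> {} \<Longrightarrow> \<Inter>\<K> \<in> \<Z>"
proof -
  have BV: "B \<subseteq> carrier V" using B by (simp add: basis_def)
  have mem: "lincomb c B \<in> carrier V" if "c \<in> B \<rightarrow> carrier K" for c using BV that by simp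
  let ?P = "indexed_pset B (carrier K)"
  have one: "{indexed_const \<one>\<^bsub>K\<^esub>} \<subseteq> ?P" by (auto intro: indexed_pset.indexed_const)
  have "zariski_zero_set K V B {indexed_const \<one>\<^bsub>K\<^esub>} = {}"
    by (rule zariski_zero_set_eqI[OF B one]) (auto simp: indexed_poly_eval_const)
  then show "{} \<in> \<Z>" unfolding \<Z>_def using one by blast
  have "zariski_zero_set K V B {} = carrier V"
    by (rule zariski_zero_set_eqI[OF B]) (use mem in auto)
  then show "carrier V \<in> \<Z>" unfolding \<Z>_def by blast
  show "A \<union> C \<in> \<Z>" if "A \<in> \<Z>" "C \<in> \<Z>" for A C
  proof -
    obtain F G where F: "F \<subseteq> ?P" "A = zariski_zero_set K V B F"
      and G: "G \<subseteq> ?P" "C = zariski_zero_set K V B G" using \<open>A \<in> \<Z>\<close> \<open>C \<in> \<Z>\<close> unfolding \<Z>_def by blast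
    define H where "H = {S \<in> ?P. \<exists>P\<in>F. \<exists>Q\<in>G. \<forall>c\<in>B \<rightarrow> carrier K.
      indexed_poly_eval K S c = indexed_poly_eval K P c \<otimes>\<^bsub>K\<^esub> indexed_poly_eval K Q c}"
    have H: "H \<subseteq> ?P" by (auto simp: H_def)
    have "zariski_zero_set K V B H = A \<union> C"
    proof (rule zariski_zero_set_eqI[OF B H])
      show "A \<union> C \<subseteq> carrier V" using F G zariski_zero_set_subset[OF B(2)] by simp
      fix c assume c: "c \<in> B \<rightarrow> carrier K"
      note iff = lincomb_in_zariski_zero_set_iff[OF B _ c]
      have cl: "indexed_poly_eval K P c \<in> carrier K" if "P \<in> ?P" for P
        using indexed_poly_eval_closed[OF that c] .
      show "lincomb c B \<in> A \<union> C \<longleftrightarrow> (\<forall>P\<in>H. indexed_poly_eval K P c = \<zero>\<^bsub>K\<^esub>)"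
      proof
        assume "lincomb c B \<in> A \<union> C"
        then have fg: "(\<forall>P\<in>F. indexed_poly_eval K P c = \<zero>\<^bsub>K\<^esub>) \<or> (\<forall>P\<in>G. indexed_poly_eval K P c = \<zero>\<^bsub>K\<^esub>)"
          using iff[OF F(1)] iff[OF G(1)] F(2) G(2) by blast
        show "\<forall>P\<in>H. indexed_poly_eval K P c = \<zero>\<^bsub>K\<^esub>"
        proof
          fix S assume "S \<in> H"
          then obtain P Q where PQ: "P \<in> F" "Q \<in> G"
            "indexed_poly_eval K S c = indexed_poly_eval K P c \<otimes>\<^bsub>K\<^esub> indexed_poly_eval K Q c"
            using c unfolding H_def by blast
          have "indexed_poly_eval K P c \<in> carrier K" "indexed_poly_eval K Q c \<in> carrier K"
            using cl PQ F(1) G(1) by auto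
          then show "indexed_poly_eval K S c = \<zero>\<^bsub>K\<^esub>"
            using fg PQ by (auto simp: PQ(3))
        qed
      next
        assume z: "\<forall>P\<in>H. indexed_poly_eval K P c = \<zero>\<^bsub>K\<^esub>"
        show "lincomb c B \<in> A \<union> C"
        proof (rule ccontr)
          assume "lincomb c B \<notin> A \<union> C"
          then obtain P Q where PQ: "P \<in> F" "Q \<in> G"
            "indexed_poly_eval K P c \<noteq> \<zero>\<^bsub>K\<^esub>" "indexed_poly_eval K Q c \<noteq> \<zero>\<^bsub>K\<^esub>"
            using iff[OF F(1)] iff[OF G(1)] F(2) G(2) by blast
          have P: "P \<in> ?P" "Q \<in> ?P" using PQ F(1) G(1) by auto
          obtain S where S: "S \<in> ?P" "\<forall>c\<in>B \<rightarrow> carrier K.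
            indexed_poly_eval K S c = indexed_poly_eval K P c \<otimes>\<^bsub>K\<^esub> indexed_poly_eval K Q c"
            using indexed_poly_product[OF P] by blast
          then have "S \<in> H" unfolding H_def using PQ(1,2) by blast
          then have "indexed_poly_eval K P c \<otimes>\<^bsub>K\<^esub> indexed_poly_eval K Q c = \<zero>\<^bsub>K\<^esub>"
            using z S(2) c by auto
          then show False using PQ(3,4) cl[OF P(1)] cl[OF P(2)] integral by blast
        qed
      qed
    qed
    then show ?thesis unfolding \<Z>_def using H by blast
  qed
  show "\<Inter>\<K> \<in> \<Z>" if K: "\<K> \<subseteq> \<Z>" "\<K> \<noteq> {}" for \<K>
  proof -
    have "\<forall>C\<in>\<K>. \<exists>F. F \<subseteq> ?P \<and> C = zariski_zero_set K V B F" using K(1) unfolding \<Z>_def by blast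
    then obtain f where f: "\<forall>C\<in>\<K>. f C \<subseteq> ?P \<and> C = zariski_zero_set K V B (f C)" by metis
    have H: "\<Union>(f ` \<K>) \<subseteq> ?P" using f by blast
    have "zariski_zero_set K V B (\<Union>(f ` \<K>)) = \<Inter>\<K>"
    proof (rule zariski_zero_set_eqI[OF B H])
      show "\<Inter>\<K> \<subseteq> carrier V" using K(2) f zariski_zero_set_subset[OF B(2)] by blast
      fix c assume c: "c \<in> B \<rightarrow> carrier K"
      have "lincomb c B \<in> C \<longleftrightarrow> (\<forall>P\<in>f C. indexed_poly_eval K P c = \<zero>\<^bsub>K\<^esub>)" if "C \<in> \<K>" for C
        using lincomb_in_zariski_zero_set_iff[OF B _ c, of "f C"] f that by blast
      then show "lincomb c B \<in> \<Inter>\<K> \<longleftrightarrow> (\<forall>P\<in>\<Union>(f ` \<K>). indexed_poly_eval K P c = \<zero>\<^bsub>K\<^esub>)"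
        by blast
    qed
    then show ?thesis unfolding \<Z>_def using H by blast
  qed
qed

text \<open>
  A name for the basis that the definition of the Zariski topology picks.
\<close>
definition chosen_basis :: "'c set" where
  "chosen_basis = (SOME B. finite B \<and> basis B)"

lemma chosen_basis_is_basis:
  assumes fin_dim
  shows "finite chosen_basis" "basis chosen_basis"
  using someI_ex[OF finite_basis_exists[OF assms]] unfolding chosen_basis_def by auto

lemma zariski_topology_by_closed_sets:
  assumes fin_dim
  defines "\<Z> \<equiv> {zariski_zero_set K V chosen_basis F | F. F \<subseteq> indexed_pset chosen_basis (carrier K)}"
  shows openin_zariski_topology: "openin (zariski_topology K V) U \<longleftrightarrow> (\<exists>C\<in>\<Z>. U = carrier V - C)"
    and topspace_zariski_topology: "topspace (zariski_topology K V) = carrier V"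
    and closedin_zariski_topology: "closedin (zariski_topology K V) A \<longleftrightarrow> A \<in> \<Z>"
proof -
  note B = chosen_basis_is_basis[OF assms(1)]
  have e: "zariski_topology K V = topology_of_closed (carrier V) \<Z>"
    unfolding zariski_topology_def \<Z>_def chosen_basis_def Let_def ..
  note cl = zariski_closed_sets[OF B, folded \<Z>_def]
  have sub: "\<And>C. C \<in> \<Z> \<Longrightarrow> C \<subseteq> carrier V"
    using zariski_zero_set_subset[OF B(2)] unfolding \<Z>_def by blast
  show "openin (zariski_topology K V) U \<longleftrightarrow> (\<exists>C\<in>\<Z>. U = carrier V - C)"
    "topspace (zariski_topology K V) = carrier V"
    "closedin (zariski_topology K V) A \<longleftrightarrow> A \<in> \<Z>"
    unfolding e by (rule openin_topology_of_closed topspace_topology_of_closed closedin_topology_of_closed;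
      use cl sub in blast)+
qed

text \<open>
  Two nonempty open sets contain points at which some polynomial of the respective defining family
  does not vanish; a common nonzero of the two polynomials lies in both.
\<close>
lemma irreducible_zariski_topology:
  assumes fd: fin_dim and inf: "infinite (carrier K)"
  shows "irreducible_space (zariski_topology K V)"
  unfolding irreducible_space_def
proof (intro allI impI, elim conjE)
  fix U W assume "openin (zariski_topology K V) U" "openin (zariski_topology K V) W"
    and ne: "U \<noteq> {}" "W \<noteq> {}"
  note B = chosen_basis_is_basis[OF fd]
  let ?P = "indexed_pset chosen_basis (carrier K)"
  obtain F G where F: "F \<subseteq> ?P" "U = carrier V - zariski_zero_set K V chosen_basis F"
    and G: "G \<subseteq> ?P" "W = carrier V - zariski_zero_set K V chosen_basis G"
    using \<open>openin _ U\<close> \<open>openin _ W\<close> unfolding openin_zariski_topology[OF fd] by blast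
  have point: "\<exists>P\<in>F. \<exists>c \<in> chosen_basis \<rightarrow> carrier K. indexed_poly_eval K P c \<noteq> \<zero>\<^bsub>K\<^esub>"
    if F: "F \<subseteq> ?P" and ne: "carrier V - zariski_zero_set K V chosen_basis F \<noteq> {}" for F
  proof -
    obtain v where v: "v \<in> carrier V" "v \<notin> zariski_zero_set K V chosen_basis F" using ne by blast
    obtain c where c: "c \<in> chosen_basis \<rightarrow>\<^sub>E carrier K" "v = lincomb c chosen_basis"
      using basis_lincomb_exists[OF B v(1)] by blast
    then have c': "c \<in> chosen_basis \<rightarrow> carrier K" by auto
    then show ?thesis using v(2) lincomb_in_zariski_zero_set_iff[OF B F c'] c(2) by blast
  qed
  obtain P a where P: "P \<in> F" "a \<in> chosen_basis \<rightarrow> carrier K" "indexed_poly_eval K P a \<noteq> \<zero>\<^bsub>K\<^esub>"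
    using point[OF F(1)] ne F(2) by blast
  obtain Q b where Q: "Q \<in> G" "b \<in> chosen_basis \<rightarrow> carrier K" "indexed_poly_eval K Q b \<noteq> \<zero>\<^bsub>K\<^esub>"
    using point[OF G(1)] ne G(2) by blast
  have PQ: "P \<in> ?P" "Q \<in> ?P" using P Q F G by auto
  obtain c where c: "c \<in> chosen_basis \<rightarrow>\<^sub>E carrier K" "indexed_poly_eval K P c \<noteq> \<zero>\<^bsub>K\<^esub>"
    "indexed_poly_eval K Q c \<noteq> \<zero>\<^bsub>K\<^esub>"
    using indexed_poly_common_nonzero[OF inf PQ P(2,3) Q(2,3)] by blast
  then have c': "c \<in> chosen_basis \<rightarrow> carrier K" by auto
  have "lincomb c chosen_basis \<in> carrier V" using B(2) c' by (simp add: basis_def)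
  moreover have "lincomb c chosen_basis \<notin> zariski_zero_set K V chosen_basis F"
    using lincomb_in_zariski_zero_set_iff[OF B F(1) c'] P c by blast
  moreover have "lincomb c chosen_basis \<notin> zariski_zero_set K V chosen_basis G"
    using lincomb_in_zariski_zero_set_iff[OF B G(1) c'] Q c by blast
  ultimately show "U \<inter> W \<noteq> {}" using F(2) G(2) by blast
qed

context
  fixes l
  assumes l: "l \<in> carrier V \<rightarrow> carrier K"
    and add: "\<And>x y. x \<in> carrier V \<Longrightarrow> y \<in> carrier V \<Longrightarrow> l (x \<oplus>\<^bsub>V\<^esub> y) = l x \<oplus>\<^bsub>K\<^esub> l y"
    and smult: "\<And>r x. r \<in> carrier K \<Longrightarrow> x \<in> carrier V \<Longrightarrow> l (r \<odot>\<^bsub>V\<^esub> x) = r \<otimes>\<^bsub>K\<^esub> l x"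
begin

text \<open>
  In the coordinates of a basis the functional \<open>l\<close> is the linear form with coefficients \<open>l b\<close>.
\<close>
lemma closedin_zariski_kernel:
  assumes fd: fin_dim
  shows "closedin (zariski_topology K V) {v \<in> carrier V. l v = \<zero>\<^bsub>K\<^esub>}"
proof -
  note B = chosen_basis_is_basis[OF fd]
  have BV: "chosen_basis \<subseteq> carrier V" using B by (simp add: basis_def)
  have "l \<in> chosen_basis \<rightarrow> carrier K" using l BV by auto
  then obtain P where P: "P \<in> indexed_pset chosen_basis (carrier K)"
    "\<And>c. c \<in> chosen_basis \<rightarrow> carrier K \<Longrightarrow>
      indexed_poly_eval K P c = (\<Oplus>\<^bsub>K\<^esub>b\<in>chosen_basis. c b \<otimes>\<^bsub>K\<^esub> l b)"
    using linear_form_indexed_poly[OF B(1) subset_refl] by blast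
  have "zariski_zero_set K V chosen_basis {P} = {v \<in> carrier V. l v = \<zero>\<^bsub>K\<^esub>}"
  proof (rule zariski_zero_set_eqI[OF B])
    fix c assume c: "c \<in> chosen_basis \<rightarrow> carrier K"
    have "l (lincomb c chosen_basis) = indexed_poly_eval K P c"
      unfolding P(2)[OF c] by (rule linear_functional_lincomb[OF B(1) BV c l add smult])
    then show "lincomb c chosen_basis \<in> {v \<in> carrier V. l v = \<zero>\<^bsub>K\<^esub>} \<longleftrightarrow>
        (\<forall>P\<in>{P}. indexed_poly_eval K P c = \<zero>\<^bsub>K\<^esub>)"
      using BV c by simp
  qed (use P in auto)
  then show ?thesis unfolding closedin_zariski_topology[OF fd] using P(1) by blast
qed

lemma kernel_trivial_if_dim_le_1:
  assumes fd: fin_dim and dim: "dim \<le> 1" and z: "z \<in> carrier V" "l z \<noteq> \<zero>\<^bsub>K\<^esub>"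
  shows "{v \<in> carrier V. l v = \<zero>\<^bsub>K\<^esub>} = {\<zero>\<^bsub>V\<^esub>}"
proof -
  obtain B where B: "finite B" "basis B" using finite_basis_exists[OF fd] by blast
  have BV: "B \<subseteq> carrier V" using B by (simp add: basis_def)
  have form: "l (lincomb c B) = (\<Oplus>\<^bsub>K\<^esub>b\<in>B. c b \<otimes>\<^bsub>K\<^esub> l b)" if "c \<in> B \<rightarrow> carrier K" for c
    by (rule linear_functional_lincomb[OF B(1) BV that l add smult])
  obtain d where d: "d \<in> B \<rightarrow>\<^sub>E carrier K" "z = lincomb d B"
    using basis_lincomb_exists[OF B z(1)] by blast
  have "B \<noteq> {}"
  proof
    assume "B = {}"
    then have "l z = \<zero>\<^bsub>K\<^esub>" using form[of d] d by auto
    then show False using z by simp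
  qed
  moreover have "card B \<le> 1" using dim dim_basis[OF B] by simp
  ultimately obtain b where b: "B = {b}"
    using B(1) by (metis card_0_eq card_1_singletonE le_antisym less_one linorder_not_le)
  have bV: "b \<in> carrier V" "l b \<in> carrier K" using BV b l by auto
  have val: "l (lincomb c B) = c b \<otimes>\<^bsub>K\<^esub> l b" if "c \<in> B \<rightarrow> carrier K" for c
    using form[OF that] that b bV by simp
  have dB: "d \<in> B \<rightarrow> carrier K" using d(1) by (auto simp: PiE_iff)
  then have "d b \<in> carrier K" using b by auto
  then have "l b \<noteq> \<zero>\<^bsub>K\<^esub>" using val[OF dB] d(2) z(2) by auto
  have "v = \<zero>\<^bsub>V\<^esub>" if v: "v \<in> carrier V" "l v = \<zero>\<^bsub>K\<^esub>" for v
  proof -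
    obtain c where c: "c \<in> B \<rightarrow>\<^sub>E carrier K" "v = lincomb c B"
      using basis_lincomb_exists[OF B v(1)] by blast
    have cB: "c \<in> B \<rightarrow> carrier K" using c(1) by (auto simp: PiE_iff)
    then have c': "c b \<in> carrier K" using b by auto
    have "c b \<otimes>\<^bsub>K\<^esub> l b = \<zero>\<^bsub>K\<^esub>" using val[OF cB] c(2) v(2) by simp
    then have "c b = \<zero>\<^bsub>K\<^esub>" using integral[OF _ c' bV(2)] \<open>l b \<noteq> \<zero>\<^bsub>K\<^esub>\<close> by blast
    then show ?thesis using c b bV by (simp add: lincomb_def)
  qed
  moreover have "l \<zero>\<^bsub>V\<^esub> = \<zero>\<^bsub>K\<^esub>"
  proof -
    have "l \<zero>\<^bsub>V\<^esub> = l (\<zero>\<^bsub>K\<^esub> \<odot>\<^bsub>V\<^esub> \<zero>\<^bsub>V\<^esub>)" by simp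
    also have "\<dots> = \<zero>\<^bsub>K\<^esub> \<otimes>\<^bsub>K\<^esub> l \<zero>\<^bsub>V\<^esub>" by (rule smult) auto
    also have "\<dots> = \<zero>\<^bsub>K\<^esub>" using l by (intro l_null) auto
    finally show ?thesis .
  qed
  ultimately show ?thesis by auto
qed

end

text \<open>
  For two distinct basis vectors, the hyperplanes \<open>r c\<^sub>1 + s c\<^sub>2 = 0\<close> in the two corresponding coordinates
  cover the space when \<open>(r : s)\<close> runs through the projective line. It is enough to take \<open>s = 1\<close>
  and the point at infinity \<open>(1 : 0)\<close>.
\<close>
lemma covered_by_pencil_of_hyperplanes:
  assumes fd: fin_dim and dim: "dim \<ge> 2" and inf: "infinite (carrier K)"
  shows "\<exists>\<W>. |\<W>| \<le>o |carrier K| \<and> \<Union>\<W> = carrier V \<and>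
    (\<forall>W\<in>\<W>. Module.submodule W K V \<and> W \<noteq> carrier V)"
proof -
  obtain B where B: "finite B" "basis B" using finite_basis_exists[OF fd] by blast
  have BV: "B \<subseteq> carrier V" using B by (simp add: basis_def)
  have "card B \<ge> 2" using dim dim_basis[OF B] by simp
  then obtain b1 b2 where b: "b1 \<in> B" "b2 \<in> B" "b1 \<noteq> b2"
    using card_2_iff' by (metis Suc_le_eq card_le_Suc0_iff_eq B(1) numeral_2_eq_2 not_less)
  define H where "H r s = {lincomb c B | c. c \<in> B \<rightarrow> carrier K \<and> r \<otimes>\<^bsub>K\<^esub> c b1 \<oplus>\<^bsub>K\<^esub> s \<otimes>\<^bsub>K\<^esub> c b2 = \<zero>\<^bsub>K\<^esub>}" for r s
  have HI: "lincomb c B \<in> H r s"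
    if "c \<in> B \<rightarrow> carrier K" "r \<otimes>\<^bsub>K\<^esub> c b1 \<oplus>\<^bsub>K\<^esub> s \<otimes>\<^bsub>K\<^esub> c b2 = \<zero>\<^bsub>K\<^esub>" for c r s
    using that unfolding H_def by blast
  have sub: "Module.submodule (H r s) K V" if rs: "r \<in> carrier K" "s \<in> carrier K" for r s
    unfolding linear_combinations_submodule_iff[symmetric]
  proof (intro LinearCombinations.submodule.intro module_axioms)
    show "H r s \<subseteq> carrier V" using BV unfolding H_def by auto
    have "lincomb (\<lambda>_. \<zero>\<^bsub>K\<^esub>) B = \<zero>\<^bsub>V\<^esub>" using BV unfolding lincomb_def
      by (intro M.finsum_all0) auto
    then show "\<zero>\<^bsub>V\<^esub> \<in> H r s" using HI[of "\<lambda>_. \<zero>\<^bsub>K\<^esub>" r s] rs by simp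
  next
    fix v w assume "v \<in> H r s" "w \<in> H r s"
    then obtain c d where c: "c \<in> B \<rightarrow> carrier K" "v = lincomb c B"
        "r \<otimes>\<^bsub>K\<^esub> c b1 \<oplus>\<^bsub>K\<^esub> s \<otimes>\<^bsub>K\<^esub> c b2 = \<zero>\<^bsub>K\<^esub>"
      and d: "d \<in> B \<rightarrow> carrier K" "w = lincomb d B"
        "r \<otimes>\<^bsub>K\<^esub> d b1 \<oplus>\<^bsub>K\<^esub> s \<otimes>\<^bsub>K\<^esub> d b2 = \<zero>\<^bsub>K\<^esub>" unfolding H_def by blast
    have m: "c b1 \<in> carrier K" "c b2 \<in> carrier K" "d b1 \<in> carrier K" "d b2 \<in> carrier K"
      using c d b by auto
    have "r \<otimes>\<^bsub>K\<^esub> (c b1 \<oplus>\<^bsub>K\<^esub> d b1) \<oplus>\<^bsub>K\<^esub> s \<otimes>\<^bsub>K\<^esub> (c b2 \<oplus>\<^bsub>K\<^esub> d b2)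
      = (r \<otimes>\<^bsub>K\<^esub> c b1 \<oplus>\<^bsub>K\<^esub> s \<otimes>\<^bsub>K\<^esub> c b2) \<oplus>\<^bsub>K\<^esub> (r \<otimes>\<^bsub>K\<^esub> d b1 \<oplus>\<^bsub>K\<^esub> s \<otimes>\<^bsub>K\<^esub> d b2)"
      using m rs by (simp add: r_distr R.a_ac)
    then have "lincomb (\<lambda>b. c b \<oplus>\<^bsub>K\<^esub> d b) B \<in> H r s"
      using c d by (intro HI) auto
    then show "v \<oplus>\<^bsub>V\<^esub> w \<in> H r s" using lincomb_sum[OF B(1) BV c(1) d(1)] c d by simp
  next
    fix t v assume t: "t \<in> carrier K" and "v \<in> H r s"
    then obtain c where c: "c \<in> B \<rightarrow> carrier K" "v = lincomb c B"
        "r \<otimes>\<^bsub>K\<^esub> c b1 \<oplus>\<^bsub>K\<^esub> s \<otimes>\<^bsub>K\<^esub> c b2 = \<zero>\<^bsub>K\<^esub>" unfolding H_def by blast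
    have m: "c b1 \<in> carrier K" "c b2 \<in> carrier K" using c b by auto
    have "r \<otimes>\<^bsub>K\<^esub> (t \<otimes>\<^bsub>K\<^esub> c b1) \<oplus>\<^bsub>K\<^esub> s \<otimes>\<^bsub>K\<^esub> (t \<otimes>\<^bsub>K\<^esub> c b2)
      = t \<otimes>\<^bsub>K\<^esub> (r \<otimes>\<^bsub>K\<^esub> c b1 \<oplus>\<^bsub>K\<^esub> s \<otimes>\<^bsub>K\<^esub> c b2)"
      using m rs t by (simp add: r_distr m_lcomm)
    then have "lincomb (\<lambda>b. t \<otimes>\<^bsub>K\<^esub> c b) B \<in> H r s"
      using c t by (intro HI) auto
    then show "t \<odot>\<^bsub>V\<^esub> v \<in> H r s" using lincomb_smult[OF BV c(1) t] c by simp
  qed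
  have proper: "H r s \<noteq> carrier V"
    if rs: "r \<in> carrier K" "s \<in> carrier K" "r \<noteq> \<zero>\<^bsub>K\<^esub> \<or> s \<noteq> \<zero>\<^bsub>K\<^esub>" for r s
  proof
    assume H: "H r s = carrier V"
    have *: "r \<otimes>\<^bsub>K\<^esub> d b1 \<oplus>\<^bsub>K\<^esub> s \<otimes>\<^bsub>K\<^esub> d b2 = \<zero>\<^bsub>K\<^esub>" if d: "d \<in> B \<rightarrow> carrier K" for d
    proof -
      have "lincomb d B \<in> H r s" using d BV unfolding H by simp
      then obtain c where c: "c \<in> B \<rightarrow> carrier K" "lincomb d B = lincomb c B"
        "r \<otimes>\<^bsub>K\<^esub> c b1 \<oplus>\<^bsub>K\<^esub> s \<otimes>\<^bsub>K\<^esub> c b2 = \<zero>\<^bsub>K\<^esub>" unfolding H_def by blast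
      have "d b1 = c b1" "d b2 = c b2" using basis_lincomb_inj[OF B d c(1,2)] b by auto
      then show ?thesis using c(3) by simp
    qed
    \<comment> \<open>evaluate the equation at the two basis vectors themselves\<close>
    have "r = \<zero>\<^bsub>K\<^esub>" using *[of "\<lambda>b. if b = b1 then \<one>\<^bsub>K\<^esub> else \<zero>\<^bsub>K\<^esub>"] rs b by auto
    moreover have "s = \<zero>\<^bsub>K\<^esub>" using *[of "\<lambda>b. if b = b2 then \<one>\<^bsub>K\<^esub> else \<zero>\<^bsub>K\<^esub>"] rs b by auto
    ultimately show False using rs by blast
  qed
  \<comment> \<open>the single hyperplane at infinity is written as a constant image, so that both parts are images of \<open>K\<close>\<close>
  let ?W = "(\<lambda>r. H r \<one>\<^bsub>K\<^esub>) ` carrier K \<union> (\<lambda>_. H \<one>\<^bsub>K\<^esub> \<zero>\<^bsub>K\<^esub>) ` carrier K"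
  have "Cinfinite |carrier K|"
    using inf by (simp add: cinfinite_def Field_card_of card_of_card_order_on)
  then have "|?W| \<le>o |carrier K|" by (intro Un_Cinfinite_bound card_of_image)
  moreover have "\<forall>W\<in>?W. Module.submodule W K V \<and> W \<noteq> carrier V"
    using sub proper by auto
  moreover have "carrier V \<subseteq> \<Union>?W"
  proof
    fix v assume v: "v \<in> carrier V"
    obtain c where "c \<in> B \<rightarrow>\<^sub>E carrier K" and vc: "v = lincomb c B"
      using basis_lincomb_exists[OF B v] by blast
    then have c: "c \<in> B \<rightarrow> carrier K" by auto
    then have m: "c b1 \<in> carrier K" "c b2 \<in> carrier K" using b by auto
    show "v \<in> \<Union>?W"
    proof (cases "c b1 = \<zero>\<^bsub>K\<^esub>")
      case True
      then have "v \<in> H \<one>\<^bsub>K\<^esub> \<zero>\<^bsub>K\<^esub>" unfolding vc using c m by (intro HI) auto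
      then show ?thesis by blast
    next
      case False
      let ?i = "inv\<^bsub>K\<^esub> (c b1)"
      have i: "?i \<in> carrier K" "?i \<otimes>\<^bsub>K\<^esub> c b1 = \<one>\<^bsub>K\<^esub>"
        using False m field_Units by auto
      let ?r = "\<ominus>\<^bsub>K\<^esub> (c b2 \<otimes>\<^bsub>K\<^esub> ?i)"
      have "?r \<otimes>\<^bsub>K\<^esub> c b1 \<oplus>\<^bsub>K\<^esub> \<one>\<^bsub>K\<^esub> \<otimes>\<^bsub>K\<^esub> c b2 = \<zero>\<^bsub>K\<^esub>"
        using m i by (simp add: l_minus m_assoc R.l_neg)
      then have "v \<in> H ?r \<one>\<^bsub>K\<^esub>" unfolding vc using c by (intro HI)
      moreover have "?r \<in> carrier K" using m i by simp
      ultimately show ?thesis by blast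
    qed
  qed
  moreover have "\<Union>?W \<subseteq> carrier V"
  proof (rule Union_least)
    fix W assume "W \<in> ?W"
    then show "W \<subseteq> carrier V" using submoduleE(1)[OF sub] by auto
  qed
  ultimately show ?thesis by (intro exI[of _ ?W] conjI subset_antisym)
qed

end

section \<open>The topologies of the residue modules\<close>

lemma (in abelian_group) minus_minus_cancel_left:
  assumes "x \<in> carrier G" "y \<in> carrier G" "w \<in> carrier G"
  shows "(x \<ominus> w) \<ominus> (x \<ominus> y) = y \<ominus> w"
proof -
  have "(x \<ominus> w) \<ominus> (x \<ominus> y) = x \<oplus> (\<ominus> x \<oplus> (y \<oplus> \<ominus> w))"
    using assms by (simp add: a_minus_def minus_add a_ac)
  then show ?thesis using assms by (simp only: r_neg2 a_minus_def a_closed a_inv_closed)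
qed

lemma (in abelian_group) minus_minus_cancel_right:
  assumes "x \<in> carrier G" "y \<in> carrier G" "w \<in> carrier G"
  shows "(x \<ominus> w) \<ominus> (y \<ominus> w) = x \<ominus> y"
proof -
  have "(x \<ominus> w) \<ominus> (y \<ominus> w) = w \<oplus> (\<ominus> w \<oplus> (x \<oplus> \<ominus> y))"
    using assms by (simp add: a_minus_def minus_add a_ac)
  then show ?thesis using assms by (simp only: r_neg2 a_minus_def a_closed a_inv_closed)
qed

context module
begin

text \<open>
  In this topology the nonempty open sets are the whole space and the complement of zero. They are
  nested, hence the space is irreducible.
\<close>
lemma coarse_residue_topology:
  assumes I: "ideal I R"
  defines "V \<equiv> residue_module R M I"
  defines "T \<equiv> topology_of_closed (carrier V) {{}, {\<zero>\<^bsub>V\<^esub>}, carrier V}"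
  shows "topspace T = carrier V" "closedin T {\<zero>\<^bsub>V\<^esub>}" "irreducible_space T"
proof -
  let ?C = "{{}, {\<zero>\<^bsub>V\<^esub>}, carrier V}"
  interpret V: module "R Quot I" V unfolding V_def by (rule residue_module_is_module[OF I])
  have sub: "C \<subseteq> carrier V" if "C \<in> ?C" for C using that by auto
  have un: "A \<union> C \<in> ?C" if "A \<in> ?C" "C \<in> ?C" for A C using that sub by auto
  have int: "\<Inter>\<K> \<in> ?C" if K: "\<K> \<subseteq> ?C" "\<K> \<noteq> {}" for \<K>
  proof (cases "{} \<in> \<K> \<or> {\<zero>\<^bsub>V\<^esub>} \<in> \<K>")
    case True
    then have "\<Inter>\<K> \<subseteq> {\<zero>\<^bsub>V\<^esub>}" by auto
    then show ?thesis by (auto simp: subset_singleton_iff)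
  next
    case False
    then have "\<K> = {carrier V}" using K by auto
    then show ?thesis by simp
  qed
  have mem: "{} \<in> ?C" "carrier V \<in> ?C" by auto
  have top: "openin T U \<longleftrightarrow> (\<exists>C\<in>?C. U = carrier V - C)" "topspace T = carrier V"
    "closedin T A \<longleftrightarrow> A \<in> ?C" for U A
    unfolding T_def by (rule openin_topology_of_closed topspace_topology_of_closed
      closedin_topology_of_closed; fact mem sub un int)+
  show "topspace T = carrier V" "closedin T {\<zero>\<^bsub>V\<^esub>}" by (simp_all add: top)
  show "irreducible_space T" unfolding irreducible_space_def
  proof (intro allI impI, elim conjE)
    fix U W assume "openin T U" "openin T W" "U \<noteq> {}" "W \<noteq> {}"
    then have "U \<in> {carrier V - {\<zero>\<^bsub>V\<^esub>}, carrier V}" "W \<in> {carrier V - {\<zero>\<^bsub>V\<^esub>}, carrier V}"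
      by (auto simp: top)
    then show "U \<inter> W \<noteq> {}" using \<open>U \<noteq> {}\<close> \<open>W \<noteq> {}\<close> by auto
  qed
qed

context
  assumes fg: "fin_gen_module R M"
begin

lemma topspace_residue_topology:
  assumes m: "\<mm> \<in> mSpec R"
  shows "topspace (residue_topology R M \<mm>) = carrier (residue_module R M \<mm>)"
proof -
  have mx: "maximalideal \<mm> R" using m by (simp add: mSpec_def)
  interpret V: vectorspace "R Quot \<mm>" "residue_module R M \<mm>"
    by (rule residue_module_is_vectorspace[OF mx])
  show ?thesis
    using V.topspace_zariski_topology[OF residue_module_fin_dim[OF fg mx]]
      coarse_residue_topology(1)[OF maximalideal.axioms(1)[OF mx]]
    by (simp add: residue_topology_def Let_def)
qed

lemma irreducible_residue_topology:
  assumes m: "\<mm> \<in> mSpec R" and inf: "\<mm> \<in> S_set R M \<Longrightarrow> infinite (carrier (R Quot \<mm>))"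
  shows "irreducible_space (residue_topology R M \<mm>)"
proof -
  have mx: "maximalideal \<mm> R" using m by (simp add: mSpec_def)
  interpret V: vectorspace "R Quot \<mm>" "residue_module R M \<mm>"
    by (rule residue_module_is_vectorspace[OF mx])
  show ?thesis
    using V.irreducible_zariski_topology[OF residue_module_fin_dim[OF fg mx] inf]
      coarse_residue_topology(3)[OF maximalideal.axioms(1)[OF mx]]
    by (simp add: residue_topology_def Let_def)
qed

text \<open>
  If the dimension is at most one, the kernel of a nonzero functional is zero, which is one of the
  prescribed closed sets of the coarse topology; otherwise the kernel is a Zariski closed hyperplane.
\<close>
lemma closedin_residue_kernel:
  assumes m: "\<mm> \<in> mSpec R"
  defines "K \<equiv> R Quot \<mm>" and "V \<equiv> residue_module R M \<mm>"
  assumes l: "l \<in> carrier V \<rightarrow> carrier K"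
    and add: "\<And>x y. x \<in> carrier V \<Longrightarrow> y \<in> carrier V \<Longrightarrow> l (x \<oplus>\<^bsub>V\<^esub> y) = l x \<oplus>\<^bsub>K\<^esub> l y"
    and smult: "\<And>r x. r \<in> carrier K \<Longrightarrow> x \<in> carrier V \<Longrightarrow> l (r \<odot>\<^bsub>V\<^esub> x) = r \<otimes>\<^bsub>K\<^esub> l x"
    and z: "z \<in> carrier V" "l z \<noteq> \<zero>\<^bsub>K\<^esub>"
  shows "closedin (residue_topology R M \<mm>) {v \<in> carrier V. l v = \<zero>\<^bsub>K\<^esub>}"
proof -
  have mx: "maximalideal \<mm> R" using m by (simp add: mSpec_def)
  interpret V: vectorspace K V
    unfolding K_def V_def by (rule residue_module_is_vectorspace[OF mx])
  have fd: "V.fin_dim" unfolding K_def V_def by (rule residue_module_fin_dim[OF fg mx])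
  show ?thesis
  proof (cases "\<mm> \<in> S_set R M")
    case True
    then show ?thesis using V.closedin_zariski_kernel[OF l add smult fd]
      by (simp add: residue_topology_def Let_def K_def V_def)
  next
    case False
    then have "V.dim \<le> 1" using m unfolding S_set_def K_def V_def by simp
    from V.kernel_trivial_if_dim_le_1[OF l add smult fd this z]
    have "{v \<in> carrier V. l v = \<zero>\<^bsub>K\<^esub>} = {\<zero>\<^bsub>V\<^esub>}" .
    then show ?thesis
      using False coarse_residue_topology(2)[OF maximalideal.axioms(1)[OF mx]]
      by (simp add: residue_topology_def Let_def V_def)
  qed
qed

text \<open>
  Fix \<open>z\<close> outside \<open>L\<close>. By maximality every \<open>x\<close> is congruent modulo \<open>L\<close> to a multiple \<open>r z\<close>, and
  \<open>r\<close> is unique modulo the annihilator \<open>\<mm>\<close> of \<open>z\<close> in \<open>M/L\<close>. This \<open>\<mm>\<close> is a maximal ideal with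
  \<open>\<mm>M \<subseteq> L\<close>, and sending the class of \<open>x\<close> to the class of \<open>r\<close> is a nonzero linear functional on
  \<open>M/\<mm>M\<close> whose kernel is the image of \<open>L\<close>.
\<close>
lemma maximal_submodule_is_preimage_of_closed:
  assumes L: "Module.submodule L R M" "L \<noteq> carrier M"
    and max: "\<And>L'. Module.submodule L' R M \<Longrightarrow> L \<subseteq> L' \<Longrightarrow> L' \<noteq> carrier M \<Longrightarrow> L' = L"
  shows "\<exists>\<mm>\<in>mSpec R. \<exists>D. closedin (residue_topology R M \<mm>) D \<and>
    L = {x \<in> carrier M. residue_class \<mm> x \<in> D}"
proof -
  note LE = submoduleE[OF L(1)]
  obtain z where z: "z \<in> carrier M" "z \<notin> L" using L LE(1) by blast
  have cancel: "x \<in> L \<longleftrightarrow> y \<in> L" if "x \<ominus>\<^bsub>M\<^esub> y \<in> L" "x \<in> carrier M" "y \<in> carrier M" for x y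
    by (rule submodule_minus_cancel[OF L(1) that])
  \<comment> \<open>by maximality, \<open>L\<close> and any element outside \<open>L\<close> together generate \<open>M\<close>\<close>
  have gen: "\<exists>r\<in>carrier R. x \<ominus>\<^bsub>M\<^esub> r \<odot>\<^bsub>M\<^esub> w \<in> L"
    if w: "w \<in> carrier M" "w \<notin> L" and x: "x \<in> carrier M" for w x
  proof -
    let ?G = "{x \<in> carrier M. \<exists>r\<in>carrier R. x \<ominus>\<^bsub>M\<^esub> r \<odot>\<^bsub>M\<^esub> w \<in> L}"
    have GI: "y \<in> ?G" if "y \<in> carrier M" "r \<in> carrier R" "y \<ominus>\<^bsub>M\<^esub> r \<odot>\<^bsub>M\<^esub> w \<in> L" for y r
      using that by blast
    have smul: "s \<odot>\<^bsub>M\<^esub> a \<in> ?G" if s: "s \<in> carrier R" and a: "a \<in> ?G" for s a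
    proof -
      obtain r where r: "r \<in> carrier R" "a \<ominus>\<^bsub>M\<^esub> r \<odot>\<^bsub>M\<^esub> w \<in> L" "a \<in> carrier M" using a by blast
      have "s \<odot>\<^bsub>M\<^esub> a \<ominus>\<^bsub>M\<^esub> (s \<otimes> r) \<odot>\<^bsub>M\<^esub> w = s \<odot>\<^bsub>M\<^esub> (a \<ominus>\<^bsub>M\<^esub> r \<odot>\<^bsub>M\<^esub> w)"
        using s r w by (simp add: a_minus_def smult_r_distr smult_assoc1 smult_r_minus)
      then show ?thesis using GI[of "s \<odot>\<^bsub>M\<^esub> a" "s \<otimes> r"] s r LE(4) by simp
    qed
    have "Module.submodule ?G R M"
    proof (rule submoduleI)
      have "\<zero>\<^bsub>M\<^esub> \<ominus>\<^bsub>M\<^esub> \<zero> \<odot>\<^bsub>M\<^esub> w = \<zero>\<^bsub>M\<^esub>" using w by (simp add: a_minus_def M.r_neg)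
      then show "\<zero>\<^bsub>M\<^esub> \<in> ?G" using GI[of "\<zero>\<^bsub>M\<^esub>" \<zero>] submodule_zero[OF L(1)] by simp
      show "\<ominus>\<^bsub>M\<^esub> a \<in> ?G" if "a \<in> ?G" for a
        using smul[of "\<ominus> \<one>" a] that by (simp add: smult_minus_1)
      show "a \<oplus>\<^bsub>M\<^esub> b \<in> ?G" if ab: "a \<in> ?G" "b \<in> ?G" for a b
      proof -
        obtain r s where r: "r \<in> carrier R" "a \<ominus>\<^bsub>M\<^esub> r \<odot>\<^bsub>M\<^esub> w \<in> L" "a \<in> carrier M"
          and s: "s \<in> carrier R" "b \<ominus>\<^bsub>M\<^esub> s \<odot>\<^bsub>M\<^esub> w \<in> L" "b \<in> carrier M" using ab by blast
        have "a \<oplus>\<^bsub>M\<^esub> b \<ominus>\<^bsub>M\<^esub> (r \<oplus> s) \<odot>\<^bsub>M\<^esub> w = (a \<ominus>\<^bsub>M\<^esub> r \<odot>\<^bsub>M\<^esub> w) \<oplus>\<^bsub>M\<^esub> (b \<ominus>\<^bsub>M\<^esub> s \<odot>\<^bsub>M\<^esub> w)"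
          using r s w by (simp add: a_minus_def smult_l_distr M.minus_add M.a_ac)
        then show ?thesis using GI[of "a \<oplus>\<^bsub>M\<^esub> b" "r \<oplus> s"] r s LE(5) by simp
      qed
    qed (use smul in auto)
    moreover have "L \<subseteq> ?G"
    proof
      fix y assume y: "y \<in> L"
      then have "y \<ominus>\<^bsub>M\<^esub> \<zero> \<odot>\<^bsub>M\<^esub> w = y" using LE(1) w by (auto simp: a_minus_def)
      then show "y \<in> ?G" using GI[of y \<zero>] y LE(1) by auto
    qed
    moreover have "w \<in> ?G"
    proof (rule GI)
      show "w \<ominus>\<^bsub>M\<^esub> \<one> \<odot>\<^bsub>M\<^esub> w \<in> L"
        using w submodule_zero[OF L(1)] by (simp add: a_minus_def M.r_neg)
    qed (use w in auto)
    ultimately have "?G = carrier M" using max[of ?G] w(2) by blast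
    then show ?thesis using x by blast
  qed
  define \<mm> where "\<mm> = {r \<in> carrier R. r \<odot>\<^bsub>M\<^esub> z \<in> L}"
  have one: "\<one> \<notin> \<mm>" using z by (simp add: \<mm>_def)
  have I: "ideal \<mm> R"
  proof (rule idealI)
    show "ring R" by (rule R.ring_axioms)
    show "subgroup \<mm> (add_monoid R)"
    proof (rule R.add.subgroupI)
      show "\<mm> \<noteq> {}" using submodule_zero[OF L(1)] z by (auto simp: \<mm>_def intro: exI[of _ \<zero>])
      show "\<ominus> a \<in> \<mm>" if "a \<in> \<mm>" for a
        using that z LE(3) by (simp add: \<mm>_def smult_l_minus)
    qed (use z LE(5) in \<open>auto simp: \<mm>_def smult_l_distr\<close>)
    show "x \<otimes> a \<in> \<mm>" if "a \<in> \<mm>" "x \<in> carrier R" for a x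
      using that z LE(4) by (simp add: \<mm>_def smult_assoc1)
    then show "a \<otimes> x \<in> \<mm>" if "a \<in> \<mm>" "x \<in> carrier R" for a x
      using that by (simp add: \<mm>_def R.m_comm)
  qed
  interpret m: ideal \<mm> R by (rule I)
  have mx: "maximalideal \<mm> R"
  proof (rule maximalidealI[OF I])
    show "carrier R \<noteq> \<mm>" using one by auto
    fix J assume J: "ideal J R" "\<mm> \<subseteq> J" "J \<subseteq> carrier R"
    interpret J: ideal J R by (rule J(1))
    show "J = \<mm> \<or> J = carrier R"
    proof (cases "J = \<mm>")
      case False
      then obtain s where s: "s \<in> J" "s \<notin> \<mm>" using J(2) by blast
      have sR: "s \<in> carrier R" using s(1) J(3) by blast
      have sz: "s \<odot>\<^bsub>M\<^esub> z \<in> carrier M" "s \<odot>\<^bsub>M\<^esub> z \<notin> L" using s(2) sR z(1) unfolding \<mm>_def by simp_all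
      \<comment> \<open>\<open>s z\<close> lies outside \<open>L\<close>, so it generates \<open>z\<close> modulo \<open>L\<close>; thus \<open>s\<close> is invertible modulo \<open>\<mm>\<close>\<close>
      from gen[OF sz z(1)] obtain r where r: "r \<in> carrier R" "z \<ominus>\<^bsub>M\<^esub> r \<odot>\<^bsub>M\<^esub> (s \<odot>\<^bsub>M\<^esub> z) \<in> L" by (elim bexE)
      have eq: "(\<one> \<ominus> r \<otimes> s) \<odot>\<^bsub>M\<^esub> z = z \<ominus>\<^bsub>M\<^esub> r \<odot>\<^bsub>M\<^esub> (s \<odot>\<^bsub>M\<^esub> z)"
        using r sR z by (simp add: a_minus_def smult_l_distr smult_l_minus smult_assoc1)
      have "\<one> \<ominus> r \<otimes> s \<in> carrier R" using r(1) sR by simp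
      then have "\<one> \<ominus> r \<otimes> s \<in> \<mm>" using r(2) unfolding \<mm>_def mem_Collect_eq eq ..
      then have "\<one> \<ominus> r \<otimes> s \<in> J" using J(2) by blast
      moreover have "r \<otimes> s \<in> J" using s(1) r(1) by (rule J.I_l_closed)
      ultimately have "(\<one> \<ominus> r \<otimes> s) \<oplus> r \<otimes> s \<in> J" by (rule J.a_closed)
      moreover have "(\<one> \<ominus> r \<otimes> s) \<oplus> r \<otimes> s = \<one>" using r sR by (simp add: a_minus_def R.a_assoc R.l_neg)
      ultimately show ?thesis using J.one_imp_carrier by simp
    qed simp
  qed
  then have mS: "\<mm> \<in> mSpec R" by (simp add: mSpec_def)
  have "ideal_smult R M \<mm> \<subseteq> L"
  proof (rule ideal_smult_least[OF L(1)])
    fix a x assume a: "a \<in> \<mm>" and x: "x \<in> carrier M"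
    have aR: "a \<in> carrier R" "a \<odot>\<^bsub>M\<^esub> z \<in> L" using a unfolding \<mm>_def by blast+
    from gen[OF z x] obtain r where r: "r \<in> carrier R" "x \<ominus>\<^bsub>M\<^esub> r \<odot>\<^bsub>M\<^esub> z \<in> L" by (elim bexE)
    have "a \<odot>\<^bsub>M\<^esub> x \<ominus>\<^bsub>M\<^esub> r \<odot>\<^bsub>M\<^esub> (a \<odot>\<^bsub>M\<^esub> z) = a \<odot>\<^bsub>M\<^esub> (x \<ominus>\<^bsub>M\<^esub> r \<odot>\<^bsub>M\<^esub> z)"
      using aR r x z by (simp add: a_minus_def smult_r_distr smult_r_minus smult_assoc1[symmetric] R.m_comm)
    then have "a \<odot>\<^bsub>M\<^esub> x \<ominus>\<^bsub>M\<^esub> r \<odot>\<^bsub>M\<^esub> (a \<odot>\<^bsub>M\<^esub> z) \<in> L" using LE(4) aR r by simp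
    moreover have "r \<odot>\<^bsub>M\<^esub> (a \<odot>\<^bsub>M\<^esub> z) \<in> L" using LE(4) aR r by simp
    ultimately show "a \<odot>\<^bsub>M\<^esub> x \<in> L" using cancel[of "a \<odot>\<^bsub>M\<^esub> x" "r \<odot>\<^bsub>M\<^esub> (a \<odot>\<^bsub>M\<^esub> z)"] aR(1) r(1) x z(1) by simp
  qed
  note mL = this
  \<comment> \<open>the set of all admissible coefficients \<open>r\<close>, which is a full coset of \<open>\<mm>\<close>\<close>
  define l where "l \<xi> = {r \<in> carrier R. \<exists>x\<in>\<xi>. x \<ominus>\<^bsub>M\<^esub> r \<odot>\<^bsub>M\<^esub> z \<in> L}" for \<xi>
  note diff = M.minus_minus_cancel_right M.minus_minus_cancel_left
  have l_eq: "l (residue_class \<mm> x) = \<mm> +> r"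
    if x: "x \<in> carrier M" and r: "r \<in> carrier R" "x \<ominus>\<^bsub>M\<^esub> r \<odot>\<^bsub>M\<^esub> z \<in> L" for x r
  proof -
    have "s \<in> l (residue_class \<mm> x) \<longleftrightarrow> s \<in> \<mm> +> r" if s: "s \<in> carrier R" for s
    proof -
      have "y \<ominus>\<^bsub>M\<^esub> s \<odot>\<^bsub>M\<^esub> z \<in> L \<longleftrightarrow> x \<ominus>\<^bsub>M\<^esub> s \<odot>\<^bsub>M\<^esub> z \<in> L" if "y \<in> residue_class \<mm> x" for y
      proof (rule cancel)
        have y: "y \<in> carrier M" "y \<ominus>\<^bsub>M\<^esub> x \<in> ideal_smult R M \<mm>"
          using that submodule_coset_mem_iff[OF ideal_smult_submodule[OF I] x] by auto
        then show "(y \<ominus>\<^bsub>M\<^esub> s \<odot>\<^bsub>M\<^esub> z) \<ominus>\<^bsub>M\<^esub> (x \<ominus>\<^bsub>M\<^esub> s \<odot>\<^bsub>M\<^esub> z) \<in> L"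
          using mL diff(1)[of y x "s \<odot>\<^bsub>M\<^esub> z"] x s z by auto
      qed (use that submodule_coset_mem_iff[OF ideal_smult_submodule[OF I] x] x s z in auto)
      moreover have "x \<in> residue_class \<mm> x"
        using submodule_coset_mem_iff[OF ideal_smult_submodule[OF I] x, of x] x
          submodule_zero[OF ideal_smult_submodule[OF I]] by (simp add: a_minus_def M.r_neg)
      ultimately have "s \<in> l (residue_class \<mm> x) \<longleftrightarrow> x \<ominus>\<^bsub>M\<^esub> s \<odot>\<^bsub>M\<^esub> z \<in> L"
        unfolding l_def using s by blast
      also have "\<dots> \<longleftrightarrow> s \<odot>\<^bsub>M\<^esub> z \<ominus>\<^bsub>M\<^esub> r \<odot>\<^bsub>M\<^esub> z \<in> L"
      proof
        assume "x \<ominus>\<^bsub>M\<^esub> s \<odot>\<^bsub>M\<^esub> z \<in> L"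
        from submodule_minus[OF L(1) r(2) this] show "s \<odot>\<^bsub>M\<^esub> z \<ominus>\<^bsub>M\<^esub> r \<odot>\<^bsub>M\<^esub> z \<in> L"
          using diff(2)[of x "s \<odot>\<^bsub>M\<^esub> z" "r \<odot>\<^bsub>M\<^esub> z"] x r s z by simp
      next
        assume "s \<odot>\<^bsub>M\<^esub> z \<ominus>\<^bsub>M\<^esub> r \<odot>\<^bsub>M\<^esub> z \<in> L"
        then have "(x \<ominus>\<^bsub>M\<^esub> r \<odot>\<^bsub>M\<^esub> z) \<ominus>\<^bsub>M\<^esub> (x \<ominus>\<^bsub>M\<^esub> s \<odot>\<^bsub>M\<^esub> z) \<in> L"
          using diff(2)[of x "s \<odot>\<^bsub>M\<^esub> z" "r \<odot>\<^bsub>M\<^esub> z"] x r s z by simp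
        from cancel[OF this] show "x \<ominus>\<^bsub>M\<^esub> s \<odot>\<^bsub>M\<^esub> z \<in> L" using x r s z by simp
      qed
      also have "s \<odot>\<^bsub>M\<^esub> z \<ominus>\<^bsub>M\<^esub> r \<odot>\<^bsub>M\<^esub> z = (s \<ominus> r) \<odot>\<^bsub>M\<^esub> z"
        using s r z by (simp add: a_minus_def smult_l_distr smult_l_minus)
      also have "(s \<ominus> r) \<odot>\<^bsub>M\<^esub> z \<in> L \<longleftrightarrow> s \<ominus> r \<in> \<mm>" using s r unfolding \<mm>_def by blast
      also have "\<dots> \<longleftrightarrow> s \<in> \<mm> +> r"
        using m.a_rcos_module_minus[OF R.ring_axioms r(1) s] by simp
      finally show ?thesis .
    qed
    moreover have "\<mm> +> r \<subseteq> carrier R" using r by (simp add: m.a_subset R.a_r_coset_subset_G)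
    moreover have "l (residue_class \<mm> x) \<subseteq> carrier R" by (auto simp: l_def)
    ultimately show ?thesis by blast
  qed
  let ?V = "residue_module R M \<mm>" and ?K = "R Quot \<mm>"
  interpret h: ring_hom_ring R ?K "(+>) \<mm>" by (rule m.rcos_ring_hom_ring)
  have rep: "\<exists>x r. x \<in> carrier M \<and> r \<in> carrier R \<and> v = residue_class \<mm> x \<and> x \<ominus>\<^bsub>M\<^esub> r \<odot>\<^bsub>M\<^esub> z \<in> L
      \<and> l v = \<mm> +> r" if v: "v \<in> carrier ?V" for v
  proof -
    obtain x where x: "x \<in> carrier M" "v = residue_class \<mm> x"
      using v by (auto simp: carrier_residue_module)
    from gen[OF z x(1)] obtain r where "r \<in> carrier R" "x \<ominus>\<^bsub>M\<^esub> r \<odot>\<^bsub>M\<^esub> z \<in> L" by (elim bexE)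
    then show ?thesis using x l_eq[OF x(1)] by (intro exI[of _ x] exI[of _ r]) simp
  qed
  have lK: "l \<in> carrier ?V \<rightarrow> carrier ?K"
  proof
    fix v assume "v \<in> carrier ?V"
    from rep[OF this] show "l v \<in> carrier ?K" by (auto simp: carrier_Quot)
  qed
  have add: "l (v \<oplus>\<^bsub>?V\<^esub> w) = l v \<oplus>\<^bsub>?K\<^esub> l w" if v: "v \<in> carrier ?V" and w: "w \<in> carrier ?V" for v w
  proof -
    obtain x r where x: "x \<in> carrier M" "r \<in> carrier R" "v = residue_class \<mm> x"
      "x \<ominus>\<^bsub>M\<^esub> r \<odot>\<^bsub>M\<^esub> z \<in> L" "l v = \<mm> +> r" using rep[OF v] by (elim exE conjE)
    obtain y s where y: "y \<in> carrier M" "s \<in> carrier R" "w = residue_class \<mm> y"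
      "y \<ominus>\<^bsub>M\<^esub> s \<odot>\<^bsub>M\<^esub> z \<in> L" "l w = \<mm> +> s" using rep[OF w] by (elim exE conjE)
    have "(x \<oplus>\<^bsub>M\<^esub> y) \<ominus>\<^bsub>M\<^esub> (r \<oplus> s) \<odot>\<^bsub>M\<^esub> z = (x \<ominus>\<^bsub>M\<^esub> r \<odot>\<^bsub>M\<^esub> z) \<oplus>\<^bsub>M\<^esub> (y \<ominus>\<^bsub>M\<^esub> s \<odot>\<^bsub>M\<^esub> z)"
      using x(1,2) y(1,2) z by (simp add: a_minus_def smult_l_distr M.minus_add M.a_ac)
    then have "l (residue_class \<mm> (x \<oplus>\<^bsub>M\<^esub> y)) = \<mm> +> (r \<oplus> s)"
      using x y LE(5) by (intro l_eq) auto
    moreover have "v \<oplus>\<^bsub>?V\<^esub> w = residue_class \<mm> (x \<oplus>\<^bsub>M\<^esub> y)"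
      unfolding x(3) y(3) by (rule add_residue_module[OF I x(1) y(1)])
    moreover have "\<mm> +> (r \<oplus> s) = (\<mm> +> r) \<oplus>\<^bsub>?K\<^esub> (\<mm> +> s)" using x(2) y(2) by simp
    ultimately show ?thesis using x(5) y(5) by simp
  qed
  have smult: "l (a \<odot>\<^bsub>?V\<^esub> v) = a \<otimes>\<^bsub>?K\<^esub> l v" if a: "a \<in> carrier ?K" and v: "v \<in> carrier ?V" for a v
  proof -
    obtain x r where x: "x \<in> carrier M" "r \<in> carrier R" "v = residue_class \<mm> x"
      "x \<ominus>\<^bsub>M\<^esub> r \<odot>\<^bsub>M\<^esub> z \<in> L" "l v = \<mm> +> r" using rep[OF v] by (elim exE conjE)
    obtain s where s: "s \<in> carrier R" "a = \<mm> +> s" using a by (auto simp: carrier_Quot)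
    have "s \<odot>\<^bsub>M\<^esub> x \<ominus>\<^bsub>M\<^esub> (s \<otimes> r) \<odot>\<^bsub>M\<^esub> z = s \<odot>\<^bsub>M\<^esub> (x \<ominus>\<^bsub>M\<^esub> r \<odot>\<^bsub>M\<^esub> z)"
      using x(1,2) s(1) z by (simp add: a_minus_def smult_r_distr smult_assoc1 smult_r_minus)
    then have "l (residue_class \<mm> (s \<odot>\<^bsub>M\<^esub> x)) = \<mm> +> (s \<otimes> r)"
      using x s LE(4) by (intro l_eq) auto
    moreover have "a \<odot>\<^bsub>?V\<^esub> v = residue_class \<mm> (s \<odot>\<^bsub>M\<^esub> x)"
      unfolding x(3) s(2) by (rule smult_residue_module[OF I s(1) x(1)])
    moreover have "\<mm> +> (s \<otimes> r) = (\<mm> +> s) \<otimes>\<^bsub>?K\<^esub> (\<mm> +> r)" using x(2) s(1) by simp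
    ultimately show ?thesis using x(5) s(2) by simp
  qed
  have zero_iff: "\<mm> +> r = \<zero>\<^bsub>?K\<^esub> \<longleftrightarrow> r \<in> \<mm>" if "r \<in> carrier R" for r
  proof -
    have zero: "\<zero>\<^bsub>?K\<^esub> = \<mm>" by (simp only: FactRing_def ring.simps)
    show ?thesis unfolding zero
      using m.rcos_const_imp_mem[OF that] R.a_rcos_zero[OF I] by (intro iffI)
  qed
  have "z \<ominus>\<^bsub>M\<^esub> \<one> \<odot>\<^bsub>M\<^esub> z \<in> L" using z submodule_zero[OF L(1)] by (simp add: a_minus_def M.r_neg)
  then have "l (residue_class \<mm> z) = \<mm> +> \<one>" by (intro l_eq z) auto
  then have "l (residue_class \<mm> z) \<noteq> \<zero>\<^bsub>?K\<^esub>" using zero_iff[OF R.one_closed] one by argo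
  from closedin_residue_kernel[OF mS lK add smult residue_class_closed[OF z(1)] this]
  have "closedin (residue_topology R M \<mm>) {v \<in> carrier ?V. l v = \<zero>\<^bsub>?K\<^esub>}" .
  moreover have "x \<in> L \<longleftrightarrow> l (residue_class \<mm> x) = \<zero>\<^bsub>?K\<^esub>" if x: "x \<in> carrier M" for x
  proof -
    from gen[OF z x] obtain r where r: "r \<in> carrier R" "x \<ominus>\<^bsub>M\<^esub> r \<odot>\<^bsub>M\<^esub> z \<in> L" by (elim bexE)
    have "x \<in> L \<longleftrightarrow> r \<odot>\<^bsub>M\<^esub> z \<in> L" by (rule cancel) (use r x z in auto)
    also have "\<dots> \<longleftrightarrow> \<mm> +> r = \<zero>\<^bsub>?K\<^esub>" unfolding zero_iff[OF r(1)] using r(1) unfolding \<mm>_def by blast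
    finally show ?thesis unfolding l_eq[OF x r] .
  qed
  then have "L = {x \<in> carrier M. residue_class \<mm> x \<in> {v \<in> carrier ?V. l v = \<zero>\<^bsub>?K\<^esub>}}"
    using LE(1) by (auto simp: residue_class_closed)
  ultimately show ?thesis using mS by blast
qed

end

end

section \<open>The induced Zariski topology and coverings\<close>

context module
begin

context
  assumes fg: "fin_gen_module R M"
begin

lemma topspace_residue_product:
  "topspace (residue_product R M) = (\<Pi>\<^sub>E \<mm>\<in>mSpec R. carrier (residue_module R M \<mm>))"
  unfolding residue_product_def topspace_product_topology
  by (rule PiE_cong) (rule topspace_residue_topology[OF fg])

lemma q_map_in_topspace:
  "x \<in> carrier M \<Longrightarrow> q_map R M x \<in> topspace (residue_product R M)"
  by (auto simp: topspace_residue_product q_map_def residue_class_closed)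

text \<open>
  The Chinese remainder theorem is the density required for subsets of a product of irreducible spaces.
\<close>
lemma irreducible_q_map_image:
  assumes inf: "\<And>\<mm>. \<mm> \<in> S_set R M \<Longrightarrow> infinite (carrier (R Quot \<mm>))"
  shows "irreducible_space (subtopology (residue_product R M) (q_map R M ` carrier M))"
  unfolding residue_product_def
proof (rule irreducible_space_dense_in_product)
  show "irreducible_space (residue_topology R M \<mm>)" if "\<mm> \<in> mSpec R" for \<mm>
    by (rule irreducible_residue_topology[OF fg that inf])
  show "q_map R M ` carrier M \<subseteq> topspace (product_topology (residue_topology R M) (mSpec R))"
    using q_map_in_topspace unfolding residue_product_def by blast
  fix F :: "'a set set" and \<xi>
  assume F: "finite F" "F \<subseteq> mSpec R" and "\<And>\<mm>. \<mm> \<in> F \<Longrightarrow> \<xi> \<mm> \<in> topspace (residue_topology R M \<mm>)"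
  then have "\<forall>\<mm>\<in>F. \<exists>x\<in>carrier M. \<xi> \<mm> = residue_class \<mm> x"
    using topspace_residue_topology[OF fg] carrier_residue_module by blast
  then obtain x where x: "\<And>\<mm>. \<mm> \<in> F \<Longrightarrow> x \<mm> \<in> carrier M \<and> \<xi> \<mm> = residue_class \<mm> (x \<mm>)" by metis
  then obtain y where y: "y \<in> carrier M" "\<forall>\<mm>\<in>F. residue_class \<mm> y = residue_class \<mm> (x \<mm>)"
    using residue_classes_simultaneous[OF F, of x] by blast
  then have "\<forall>\<mm>\<in>F. q_map R M y \<mm> = \<xi> \<mm>" using F(2) x by (auto simp: q_map_def)
  then show "\<exists>d\<in>q_map R M ` carrier M. \<forall>\<mm>\<in>F. d \<mm> = \<xi> \<mm>" using y(1) by blast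
qed

lemma topspace_induced_zariski: "topspace (induced_zariski R M) = carrier M"
  using q_map_in_topspace by (auto simp: induced_zariski_def topspace_pullback_topology)

lemma closedin_induced_zariski_preimage:
  assumes m: "\<mm> \<in> mSpec R" and D: "closedin (residue_topology R M \<mm>) D"
  shows "closedin (induced_zariski R M) {x \<in> carrier M. residue_class \<mm> x \<in> D}"
proof -
  have "continuous_map (residue_product R M) (residue_topology R M \<mm>) (\<lambda>\<xi>. \<xi> \<mm>)"
    unfolding residue_product_def by (rule continuous_map_product_projection[OF m])
  moreover have "continuous_map (induced_zariski R M) (residue_product R M) (q_map R M)"
    unfolding continuous_map_def topspace_induced_zariski
    using q_map_in_topspace
    by (auto simp: induced_zariski_def openin_pullback_topology Pi_iff)
  ultimately have "continuous_map (induced_zariski R M) (residue_topology R M \<mm>) ((\<lambda>\<xi>. \<xi> \<mm>) \<circ> q_map R M)"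
    by (rule continuous_map_compose[rotated])
  from closedin_continuous_map_preimage[OF this D]
  have "closedin (induced_zariski R M) {x \<in> carrier M. ((\<lambda>\<xi>. \<xi> \<mm>) \<circ> q_map R M) x \<in> D}"
    unfolding topspace_induced_zariski .
  then show ?thesis using m by (simp add: q_map_def)
qed

lemma proper_submodule_subset_closed:
  assumes N: "Module.submodule N R M" "N \<noteq> carrier M"
  shows "\<exists>C. closedin (induced_zariski R M) C \<and> C \<noteq> carrier M \<and> N \<subseteq> C"
proof -
  obtain L where L: "Module.submodule L R M" "N \<subseteq> L" "L \<noteq> carrier M"
    "\<forall>L'. Module.submodule L' R M \<and> L \<subseteq> L' \<and> L' \<noteq> carrier M \<longrightarrow> L' = L"
    using exists_maximal_submodule[OF fg N] by blast
  have max: "L' = L" if "Module.submodule L' R M" "L \<subseteq> L'" "L' \<noteq> carrier M" for L'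
    using L(4) that by blast
  obtain \<mm> D where "\<mm> \<in> mSpec R" "closedin (residue_topology R M \<mm>) D"
    "L = {x \<in> carrier M. residue_class \<mm> x \<in> D}"
    using maximal_submodule_is_preimage_of_closed[OF fg L(1,3) max] by blast
  then have "closedin (induced_zariski R M) L" using closedin_induced_zariski_preimage by simp
  then show ?thesis using L(2,3) by blast
qed

text \<open>
  Closed subsets of \<open>M\<close> are preimages of closed subsets of the product, hence their images are closed
  in the image of \<open>M\<close>, and a proper subset is saturated for \<open>q_map\<close>, so its image is proper too.
\<close>
lemma q_map_image_nowhere_dense:
  assumes inf: "\<And>\<mm>. \<mm> \<in> S_set R M \<Longrightarrow> infinite (carrier (R Quot \<mm>))"
    and C: "closedin (induced_zariski R M) C" "C \<noteq> carrier M"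
  shows "nowhere_dense (subtopology (residue_product R M) (q_map R M ` carrier M)) (q_map R M ` C)"
proof (rule irreducible_space_closedin_nowhere_dense[OF irreducible_q_map_image[OF inf]])
  let ?P = "residue_product R M" and ?q = "q_map R M"
  have CM: "C \<subseteq> carrier M" using closedin_subset[OF C(1)] unfolding topspace_induced_zariski .
  have "openin (induced_zariski R M) (carrier M - C)"
    using C(1) unfolding closedin_def topspace_induced_zariski by blast
  then obtain U where U: "openin ?P U" "carrier M - C = ?q -` U \<inter> carrier M"
    unfolding induced_zariski_def openin_pullback_topology by blast
  have mem: "?q x \<in> U \<longleftrightarrow> x \<notin> C" if "x \<in> carrier M" for x using U(2) that by blast
  have qt: "?q ` carrier M \<subseteq> topspace ?P" using q_map_in_topspace by blast
  have "?q ` C = (topspace ?P - U) \<inter> ?q ` carrier M"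
  proof
    show "?q ` C \<subseteq> (topspace ?P - U) \<inter> ?q ` carrier M" using mem CM qt by blast
    show "(topspace ?P - U) \<inter> ?q ` carrier M \<subseteq> ?q ` C" using mem by blast
  qed
  then show "closedin (subtopology ?P (?q ` carrier M)) (?q ` C)"
    unfolding closedin_subtopology using U(1) by blast
  obtain x where x: "x \<in> carrier M" "x \<notin> C" using CM C(2) by blast
  have "?q x \<notin> ?q ` C"
  proof
    assume "?q x \<in> ?q ` C"
    then obtain y where y: "y \<in> C" "?q x = ?q y" by blast
    then show False using mem[OF x(1)] mem[of y] x CM by auto
  qed
  then show "?q ` C \<noteq> topspace (subtopology ?P (?q ` carrier M))"
    using x(1) qt by (auto simp: Int_absorb1)
qed

lemma cover_by_proper_submodules:
  assumes m: "\<mm> \<in> S_set R M" and inf: "infinite (carrier (R Quot \<mm>))"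
  shows "\<exists>\<F>. |\<F>| \<le>o |carrier (R Quot \<mm>)| \<and> \<Union>\<F> = carrier M \<and>
    (\<forall>N\<in>\<F>. Module.submodule N R M \<and> N \<noteq> carrier M)"
proof -
  have mx: "maximalideal \<mm> R" using m by (simp add: S_set_def mSpec_def)
  have I: "ideal \<mm> R" by (rule maximalideal.axioms(1)[OF mx])
  let ?V = "residue_module R M \<mm>"
  interpret V: vectorspace "R Quot \<mm>" ?V by (rule residue_module_is_vectorspace[OF mx])
  have "V.dim \<ge> 2" using m by (simp add: S_set_def)
  then obtain \<W> where W: "|\<W>| \<le>o |carrier (R Quot \<mm>)|" "\<Union>\<W> = carrier ?V"
    "\<forall>W\<in>\<W>. Module.submodule W (R Quot \<mm>) ?V \<and> W \<noteq> carrier ?V"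
    using V.covered_by_pencil_of_hyperplanes[OF residue_module_fin_dim[OF fg mx] _ inf] by blast
  let ?p = "\<lambda>W. {x \<in> carrier M. residue_class \<mm> x \<in> W}"
  have "|?p ` \<W>| \<le>o |carrier (R Quot \<mm>)|"
    using card_of_image W(1) by (rule ordLeq_transitive)
  moreover have "\<Union>(?p ` \<W>) = carrier M"
    using W(2) residue_class_closed[of _ \<mm>] by blast
  moreover have "Module.submodule (?p W) R M \<and> ?p W \<noteq> carrier M" if "W \<in> \<W>" for W
  proof
    have sub: "Module.submodule W (R Quot \<mm>) ?V" "W \<noteq> carrier ?V" using W(3) that by auto
    show "Module.submodule (?p W) R M" by (rule submodule_of_residue_module[OF I sub(1)])
    show "?p W \<noteq> carrier M"
    proof
      assume "?p W = carrier M"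
      then have "carrier ?V \<subseteq> W" unfolding carrier_residue_module by blast
      then show False using V.submoduleE(1)[OF sub(1)] sub(2) by blast
    qed
  qed
  ultimately show ?thesis by (intro exI[of _ "?p ` \<W>"]) blast
qed

end

end

theorem proposition3p7:
  fixes R :: "('r, 'x) ring_scheme" and M :: "('r, 'm, 'y) module_scheme"
  assumes "cring R"
    and "fin_gen_module R M"
    and "S_set R M \<noteq> {}"
    and "\<And>\<mm>. \<mm> \<in> S_set R M \<Longrightarrow> infinite (carrier (R Quot \<mm>))"
    and "\<not> first_category (kappa R M)
           (subtopology (residue_product R M) (q_map R M ` carrier M))"
  shows "sigma_tau R M =o kappa R M \<and> sigma R M =o kappa R M"
proof -
  note fg = assms(2) and inf = assms(4)
  interpret module R M using fg by (simp add: fin_gen_module_def)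
  let ?T = "induced_zariski R M" and ?P = "residue_product R M" and ?q = "q_map R M"
  define \<S> where "\<S> = {\<F>. (\<forall>N\<in>\<F>. Module.submodule N R M \<and> N \<noteq> carrier M) \<and> \<Union>\<F> = carrier M}"
  define \<T> where "\<T> = {\<F>. (\<forall>C\<in>\<F>. closedin ?T C \<and> C \<noteq> carrier M) \<and> \<Union>\<F> = carrier M}"
  have sigma: "sigma R M = min_card (card_of ` \<S>)" and tau: "sigma_tau R M = min_card (card_of ` \<T>)"
    unfolding sigma_def sigma_tau_def \<S>_def \<T>_def by (simp_all add: image_def conj_commute Bex_def Collect_conj_eq)
  obtain \<mm> where m: "\<mm> \<in> S_set R M" "kappa R M =o |carrier (R Quot \<mm>)|"
    using kappa_ordIso[OF assms(3) inf] by blast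
  have card: "\<And>k. k \<in> card_of ` \<A> \<Longrightarrow> Card_order k" for \<A> :: "'m set set set"
    using card_of_Card_order by auto
  obtain \<F> where F: "\<F> \<in> \<S>" "|\<F>| \<le>o |carrier (R Quot \<mm>)|"
    using cover_by_proper_submodules[OF fg m(1) inf[OF m(1)]] unfolding \<S>_def by blast
  have "sigma R M \<le>o |\<F>|" unfolding sigma by (rule min_card_le) (use F(1) card in auto)
  then have sigma_kappa: "sigma R M \<le>o kappa R M"
    using F(2) m(2) by (meson ordIso_symmetric ordLeq_ordIso_trans ordLeq_transitive)
  have to_closed: "\<exists>\<H>\<in>\<T>. |\<H>| \<le>o |\<G>|" if G: "\<G> \<in> \<S>" for \<G>
  proof -
    have "\<forall>N\<in>\<G>. \<exists>C. closedin ?T C \<and> C \<noteq> carrier M \<and> N \<subseteq> C"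
      using G proper_submodule_subset_closed[OF fg] unfolding \<S>_def by blast
    then obtain f where f: "\<forall>N\<in>\<G>. closedin ?T (f N) \<and> f N \<noteq> carrier M \<and> N \<subseteq> f N" by metis
    have "\<Union>(f ` \<G>) = carrier M"
    proof
      show "\<Union>(f ` \<G>) \<subseteq> carrier M"
        using f closedin_subset topspace_induced_zariski[OF fg] by blast
      show "carrier M \<subseteq> \<Union>(f ` \<G>)" using f G unfolding \<S>_def by blast
    qed
    then have "f ` \<G> \<in> \<T>" unfolding \<T>_def using f by blast
    then show ?thesis using card_of_image by blast
  qed
  have "sigma R M \<in> card_of ` \<S>" unfolding sigma by (rule min_card_in) (use F(1) card in auto)
  then obtain \<G> where G: "\<G> \<in> \<S>" "sigma R M = |\<G>|" by blast
  then obtain \<H> where H: "\<H> \<in> \<T>" "|\<H>| \<le>o sigma R M" using to_closed by fastforce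
  have "sigma_tau R M \<le>o |\<H>|" unfolding tau by (rule min_card_le) (use H(1) card in auto)
  then have tau_sigma: "sigma_tau R M \<le>o sigma R M" using H(2) by (rule ordLeq_transitive)
  have "sigma_tau R M \<in> card_of ` \<T>" unfolding tau by (rule min_card_in) (use H(1) card in auto)
  then obtain \<C> where C: "\<C> \<in> \<T>" "sigma_tau R M = |\<C>|" by blast
  have kappa_tau: "kappa R M \<le>o sigma_tau R M"
  proof (rule ccontr)
    assume "\<not> kappa R M \<le>o sigma_tau R M"
    moreover have "Card_order (kappa R M)" unfolding kappa_def by (rule Card_order_csum)
    ultimately have "|\<C>| <o kappa R M"
      using C(2) card_of_Well_order not_ordLeq_iff_ordLess Card_order_iff_ordLeq_card_of
      by (metis card_order_on_well_order_on)
    then have less: "|(`) ?q ` \<C>| <o kappa R M"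
      using card_of_image by (rule ordLeq_ordLess_trans[rotated])
    let ?Q = "subtopology ?P (?q ` carrier M)"
    have "nowhere_dense ?Q A" if "A \<in> (`) ?q ` \<C>" for A
      using that q_map_image_nowhere_dense[OF fg inf] C(1) unfolding \<T>_def by blast
    moreover have "topspace ?Q = ?q ` carrier M"
      using q_map_in_topspace[OF fg] by auto
    moreover have "\<Union>((`) ?q ` \<C>) = ?q ` carrier M"
      using C(1) unfolding \<T>_def by blast
    ultimately have "first_category (kappa R M) ?Q"
      unfolding first_category_def using less by (intro exI[of _ "(`) ?q ` \<C>"]) simp
    then show False using assms(5) by contradiction
  qed
  show ?thesis
    unfolding ordIso_iff_ordLeq
    using kappa_tau sigma_kappa ordLeq_transitive[OF tau_sigma sigma_kappa]
      ordLeq_transitive[OF kappa_tau tau_sigma] by (intro conjI)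
qed

end
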